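(* Let $\Gamma=(V,E)$ be an infinite weighted graph without self-loops (i.e. $\mu_{xx}=0$ for all $x\in V$). Then the following three statements are equivalent: (i) $\bar h_\infty(\Gamma)=0$; (ii) $h_\infty(\Gamma)=1$; (iii) $\sigma^{\mathrm{ess}}(\Gamma)=\{1\}$.
   Context: $\Gamma=(V,E)$ is a locally finite, connected graph with infinitely many vertices, equipped with symmetric edge weights $\mu_{xy}=\mu_{yx}\ge 0$, where $\mu_{xy}>0$ iff $(x,y)\in E$. Put $\mu(x)=\sum_{y\in V}\mu_{xy}$. For finite $U\subset V$: $\mathrm{vol}(U)=\sum_{x\in U}\mu(x)$, $|\partial U|=\sum_{x\in U}\sum_{y\notin U}\mu_{xy}$; for finite $V_1,V_2\subset V$: $|E(V_1,V_2)|=\sum_{x\in V_1}\sum_{y\in V_2}\mu_{xy}$. For a (possibly infinite) subset $\Omega\subset V$, the Cheeger constant is $h(\Omega)=\inf\{|\partial U|/\mathrm{vol}(U):\emptyset\ne U\subset\Omega,\ U\text{ finite}\}$ and the dual Cheeger constant is $\bar h(\Omega)=\sup\left\{\frac{2|E(V_1,V_2)|}{\mathrm{vol}(V_1)+\mathrm{vol}(V_2)}\right\}$, the supremum over pairs of disjoint nonempty finite subsets $V_1,V_2\subset\Omega$. The constants at infinity are $h_\infty(\Gamma)=\lim_{K\uparrow\Gamma}h(V\setminus K)$ and $\bar h_\infty(\Gamma)=\lim_{K\uparrow\Gamma}\bar h(V\setminus K)$, the limits taken along any increasing sequence of finite subsets $K$ exhausting $V$ (they exist by monotonicity and do not depend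 on the sequence). The normalized Laplace operator $\Delta$ is the bounded self-adjoint operator on $\ell^2(V,\mu)$ (inner product $(f,g)_\mu=\sum_x\mu(x)f(x)g(x)$) given by $\Delta f(x)=f(x)-\frac1{\mu(x)}\sum_{y}\mu_{xy}f(y)$. $\sigma^{\mathrm{ess}}(\Gamma)$ is its essential spectrum, i.e. the spectrum of $\Delta$ with the isolated eigenvalues of finite multiplicity removed. *)

theory Defs
  imports "HOL-Analysis.Analysis"
begin

text \<open>
  The vertex set is the universe of the type \<open>'v\<close>. Local finiteness makes every infinite sum over
  neighbours below a finite sum.
\<close>

locale weighted_graph =
  fixes E :: "('v \<times> 'v) set" and \<mu> :: "'v \<Rightarrow> 'v \<Rightarrow> real"
  assumes infinite_vertices: "infinite (UNIV :: 'v set)"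
    and weight_sym: "\<mu> x y = \<mu> y x"
    and weight_nonneg: "0 \<le> \<mu> x y"
    and weight_pos_iff: "0 < \<mu> x y \<longleftrightarrow> (x, y) \<in> E"
    and locally_finite: "finite {y. (x, y) \<in> E}"
    and connected: "(x, y) \<in> E\<^sup>*"

definition vertex_weight :: "('v \<Rightarrow> 'v \<Rightarrow> real) \<Rightarrow> 'v \<Rightarrow> real" where
  "vertex_weight \<mu> x = (\<Sum>\<^sub>\<infinity>y. \<mu> x y)"

definition vol :: "('v \<Rightarrow> 'v \<Rightarrow> real) \<Rightarrow> 'v set \<Rightarrow> real" where
  "vol \<mu> U = (\<Sum>x\<in>U. vertex_weight \<mu> x)"

definition boundary_weight :: "('v \<Rightarrow> 'v \<Rightarrow> real) \<Rightarrow> 'v set \<Rightarrow> real" where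
  "boundary_weight \<mu> U = (\<Sum>x\<in>U. \<Sum>\<^sub>\<infinity>y\<in>-U. \<mu> x y)"

definition edge_weight_between :: "('v \<Rightarrow> 'v \<Rightarrow> real) \<Rightarrow> 'v set \<Rightarrow> 'v set \<Rightarrow> real" where
  "edge_weight_between \<mu> V1 V2 = (\<Sum>x\<in>V1. \<Sum>y\<in>V2. \<mu> x y)"


subsection \<open>Cheeger constants\<close>

definition cheeger :: "('v \<Rightarrow> 'v \<Rightarrow> real) \<Rightarrow> 'v set \<Rightarrow> real" where
  "cheeger \<mu> \<Omega> = Inf {boundary_weight \<mu> U / vol \<mu> U | U. U \<noteq> {} \<and> U \<subseteq> \<Omega> \<and> finite U}"

definition dual_cheeger :: "('v \<Rightarrow> 'v \<Rightarrow> real) \<Rightarrow> 'v set \<Rightarrow> real" where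
  "dual_cheeger \<mu> \<Omega> =
     Sup {2 * edge_weight_between \<mu> V1 V2 / (vol \<mu> V1 + vol \<mu> V2) | V1 V2.
            V1 \<noteq> {} \<and> V2 \<noteq> {} \<and> finite V1 \<and> finite V2 \<and>
            V1 \<subseteq> \<Omega> \<and> V2 \<subseteq> \<Omega> \<and> V1 \<inter> V2 = {}}"

definition exhaustion :: "(nat \<Rightarrow> 'v set) \<Rightarrow> bool" where
  "exhaustion K \<longleftrightarrow> incseq K \<and> (\<forall>n. finite (K n)) \<and> (\<Union>n. K n) = UNIV"

text \<open>
  The limit along any exhaustion; see \<open>cheeger_inf_limit\<close> and \<open>dual_cheeger_inf_limit\<close> below for
  existence and uniqueness.
\<close>

definition cheeger_inf :: "('v \<Rightarrow> 'v \<Rightarrow> real) \<Rightarrow> real" where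
  "cheeger_inf \<mu> =
     (THE l. \<forall>K. exhaustion K \<longrightarrow> (\<lambda>n. cheeger \<mu> (- K n)) \<longlonglongrightarrow> l)"

definition dual_cheeger_inf :: "('v \<Rightarrow> 'v \<Rightarrow> real) \<Rightarrow> real" where
  "dual_cheeger_inf \<mu> =
     (THE l. \<forall>K. exhaustion K \<longrightarrow> (\<lambda>n. dual_cheeger \<mu> (- K n)) \<longlonglongrightarrow> l)"


subsection \<open>The Laplace operator on the weighted sequence space\<close>

definition l2 :: "('v \<Rightarrow> 'v \<Rightarrow> real) \<Rightarrow> ('v \<Rightarrow> real) set" where
  "l2 \<mu> = {f. (\<lambda>x. vertex_weight \<mu> x * (f x)\<^sup>2) summable_on UNIV}"

definition l2_inner :: "('v \<Rightarrow> 'v \<Rightarrow> real) \<Rightarrow> ('v \<Rightarrow> real) \<Rightarrow> ('v \<Rightarrow> real) \<Rightarrow> real" where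
  "l2_inner \<mu> f g = (\<Sum>\<^sub>\<infinity>x. vertex_weight \<mu> x * f x * g x)"

definition l2_norm :: "('v \<Rightarrow> 'v \<Rightarrow> real) \<Rightarrow> ('v \<Rightarrow> real) \<Rightarrow> real" where
  "l2_norm \<mu> f = sqrt (l2_inner \<mu> f f)"

definition laplace :: "('v \<Rightarrow> 'v \<Rightarrow> real) \<Rightarrow> ('v \<Rightarrow> real) \<Rightarrow> 'v \<Rightarrow> real" where
  "laplace \<mu> f x = f x - 1 / vertex_weight \<mu> x * (\<Sum>\<^sub>\<infinity>y. \<mu> x y * f y)"

definition l2_bounded_operator ::
    "('v \<Rightarrow> 'v \<Rightarrow> real) \<Rightarrow> (('v \<Rightarrow> real) \<Rightarrow> 'v \<Rightarrow> real) \<Rightarrow> bool" where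
  "l2_bounded_operator \<mu> T \<longleftrightarrow>
     (\<forall>f\<in>l2 \<mu>. T f \<in> l2 \<mu>) \<and>
     (\<forall>f\<in>l2 \<mu>. \<forall>g\<in>l2 \<mu>. T (\<lambda>x. f x + g x) = (\<lambda>x. T f x + T g x)) \<and>
     (\<forall>c. \<forall>f\<in>l2 \<mu>. T (\<lambda>x. c * f x) = (\<lambda>x. c * T f x)) \<and>
     (\<exists>C. \<forall>f\<in>l2 \<mu>. l2_norm \<mu> (T f) \<le> C * l2_norm \<mu> f)"

text \<open>
  The spectrum is the set of all \<open>t\<close> for which \<open>T - t\<close> has no bounded two-sided inverse. Only real \<open>t\<close>
  are considered, which loses nothing for self-adjoint operators such as \<open>laplace \<mu>\<close>.
\<close>

definition l2_spectrum ::
    "('v \<Rightarrow> 'v \<Rightarrow> real) \<Rightarrow> (('v \<Rightarrow> real) \<Rightarrow> 'v \<Rightarrow> real) \<Rightarrow> real set" where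
  "l2_spectrum \<mu> T = {t. \<not> (\<exists>R. l2_bounded_operator \<mu> R \<and>
     (\<forall>f\<in>l2 \<mu>. R (\<lambda>x. T f x - t * f x) = f \<and> (\<lambda>x. T (R f) x - t * R f x) = f))}"

definition l2_eigenspace ::
    "('v \<Rightarrow> 'v \<Rightarrow> real) \<Rightarrow> (('v \<Rightarrow> real) \<Rightarrow> 'v \<Rightarrow> real) \<Rightarrow> real \<Rightarrow> ('v \<Rightarrow> real) set" where
  "l2_eigenspace \<mu> T t = {f \<in> l2 \<mu>. T f = (\<lambda>x. t * f x)}"

definition finite_dimensional :: "('v \<Rightarrow> real) set \<Rightarrow> bool" where
  "finite_dimensional S \<longleftrightarrow>
     (\<exists>B. finite B \<and> B \<subseteq> S \<and> (\<forall>f\<in>S. \<exists>c. f = (\<lambda>x. \<Sum>b\<in>B. c b * b x)))"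

definition l2_essential_spectrum ::
    "('v \<Rightarrow> 'v \<Rightarrow> real) \<Rightarrow> (('v \<Rightarrow> real) \<Rightarrow> 'v \<Rightarrow> real) \<Rightarrow> real set" where
  "l2_essential_spectrum \<mu> T = l2_spectrum \<mu> T -
     {t. t isolated_in l2_spectrum \<mu> T \<and>
          l2_eigenspace \<mu> T t \<noteq> {\<lambda>x. 0} \<and> finite_dimensional (l2_eigenspace \<mu> T t)}"


subsection \<open>The Cheeger constants at infinity are well defined\<close>

lemma exhaustion_limit_exists:
  fixes G :: "'v set \<Rightarrow> real"
  assumes ex: "\<exists>K :: nat \<Rightarrow> 'v set. exhaustion K"
    and mono: "\<And>A B. finite A \<Longrightarrow> finite B \<Longrightarrow> A \<subseteq> B \<Longrightarrow> G A \<le> G B"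
    and bound: "\<And>A. finite A \<Longrightarrow> G A \<le> M"
  shows "\<exists>l. \<forall>K. exhaustion K \<longrightarrow> (\<lambda>n. G (K n)) \<longlonglongrightarrow> l"
proof (intro exI allI impI)
  fix K :: "nat \<Rightarrow> 'v set"
  assume K: "exhaustion K"
  let ?l = "Sup (G ` {A. finite A})"
  have bdd: "bdd_above (G ` {A. finite A})"
    using bound by (auto intro!: bdd_aboveI)
  show "(\<lambda>n. G (K n)) \<longlonglongrightarrow> ?l"
  proof (rule increasing_tendsto)
    show "\<forall>\<^sub>F n in sequentially. G (K n) \<le> ?l"
      using K bdd by (auto simp: exhaustion_def intro!: always_eventually cSup_upper)
  next
    fix x assume "x < ?l"
    then obtain A where A: "finite A" "x < G A"
      using less_cSup_iff[OF _ bdd] by auto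
    have "\<exists>n. A \<subseteq> K n"
      using A(1)
    proof (induction A rule: finite_induct)
      case (insert a A)
      then obtain n where n: "A \<subseteq> K n" by blast
      obtain m where m: "a \<in> K m" using K unfolding exhaustion_def by blast
      have "K n \<subseteq> K (max n m)" "K m \<subseteq> K (max n m)"
        using K by (auto simp: exhaustion_def incseq_def)
      then show ?case using n m by blast
    qed simp
    then obtain n where n: "A \<subseteq> K n" by blast
    show "\<forall>\<^sub>F n in sequentially. x < G (K n)"
      unfolding eventually_sequentially
    proof (intro exI allI impI)
      fix k assume "n \<le> k"
      then have "A \<subseteq> K k" using n K by (auto simp: exhaustion_def incseq_def)
      then show "x < G (K k)"
        using mono[of A "K k"] A K by (auto simp: exhaustion_def)
    qed
  qed
qed

lemma exhaustion_limit_THE: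
  fixes G :: "'v set \<Rightarrow> real"
  assumes K: "exhaustion K"
    and l: "\<exists>l. \<forall>K. exhaustion K \<longrightarrow> (\<lambda>n. G (K n)) \<longlonglongrightarrow> l"
  shows "(\<lambda>n. G (K n)) \<longlonglongrightarrow> (THE l. \<forall>K. exhaustion K \<longrightarrow> (\<lambda>n. G (K n)) \<longlonglongrightarrow> l)"
proof -
  obtain l where l: "\<forall>K. exhaustion K \<longrightarrow> (\<lambda>n. G (K n)) \<longlonglongrightarrow> l"
    using l by blast
  have "(THE l. \<forall>K. exhaustion K \<longrightarrow> (\<lambda>n. G (K n)) \<longlonglongrightarrow> l) = l"
    using l K by (intro the_equality) (auto intro: LIMSEQ_unique)
  then show ?thesis using l K by simp
qed

context weighted_graph
begin

lemma exhaustion_exists: "\<exists>K :: nat \<Rightarrow> 'v set. exhaustion K"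
proof -
  fix x0 :: 'v
  define K where "K n = ((\<lambda>S. S \<union> E `` S) ^^ n) {x0}" for n :: nat
  have K_Suc: "K (Suc n) = K n \<union> E `` K n" for n by (simp add: K_def)
  have "finite (K n)" for n
  proof (induction n)
    case (Suc n)
    have "E `` K n = (\<Union>x\<in>K n. {y. (x, y) \<in> E})" by auto
    then show ?case using Suc locally_finite by (simp add: K_Suc)
  qed (simp add: K_def)
  moreover have "incseq K" by (rule incseq_SucI) (simp add: K_Suc)
  moreover have "\<exists>n. y \<in> K n" for y
    using connected[of x0 y]
  proof (induction rule: rtrancl_induct)
    case base
    have "x0 \<in> K 0" by (simp add: K_def)
    then show ?case ..
  next
    case (step y z)
    then obtain n where "y \<in> K n" by blast
    then have "z \<in> K (Suc n)" using step by (auto simp: K_Suc)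
    then show ?case ..
  qed
  ultimately have "exhaustion K" by (auto simp: exhaustion_def)
  then show ?thesis by (rule exI[of _ K])
qed

lemma weight_summable: "(\<lambda>y. \<mu> x y) summable_on A"
proof -
  have "\<mu> x y = 0" if "(x, y) \<notin> E" for y
    using that weight_nonneg[of x y] weight_pos_iff[of x y] by auto
  then have "(\<lambda>y. \<mu> x y) summable_on A \<longleftrightarrow> (\<lambda>y. \<mu> x y) summable_on (A \<inter> {y. (x, y) \<in> E})"
    by (intro summable_on_cong_neutral) auto
  then show ?thesis using locally_finite by simp
qed

lemma infsum_weight_le: "(\<Sum>\<^sub>\<infinity>y\<in>A. \<mu> x y) \<le> vertex_weight \<mu> x"
  unfolding vertex_weight_def
  by (rule infsum_mono_neutral) (auto simp: weight_summable weight_nonneg)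

lemma sum_weight_le: "finite A \<Longrightarrow> (\<Sum>y\<in>A. \<mu> x y) \<le> vertex_weight \<mu> x"
  using infsum_weight_le[where A = A] by simp

lemma vertex_weight_nonneg: "0 \<le> vertex_weight \<mu> x"
  by (simp add: vertex_weight_def infsum_nonneg weight_nonneg)

lemma vol_nonneg: "0 \<le> vol \<mu> U"
  by (simp add: vol_def sum_nonneg vertex_weight_nonneg)

lemma cheeger_ratio_bounds:
  shows "0 \<le> boundary_weight \<mu> U / vol \<mu> U" and "boundary_weight \<mu> U / vol \<mu> U \<le> 1"
proof -
  have "boundary_weight \<mu> U \<le> vol \<mu> U"
    unfolding boundary_weight_def vol_def by (intro sum_mono infsum_weight_le)
  then show "boundary_weight \<mu> U / vol \<mu> U \<le> 1"
    using vol_nonneg[of U] by (auto simp: divide_le_eq_1)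
  show "0 \<le> boundary_weight \<mu> U / vol \<mu> U"
    using vol_nonneg[of U]
    by (simp add: boundary_weight_def sum_nonneg infsum_nonneg weight_nonneg)
qed

lemma dual_cheeger_ratio_bounds:
  assumes "finite V1" "finite V2"
  shows "0 \<le> 2 * edge_weight_between \<mu> V1 V2 / (vol \<mu> V1 + vol \<mu> V2)"
    and "2 * edge_weight_between \<mu> V1 V2 / (vol \<mu> V1 + vol \<mu> V2) \<le> 1"
proof -
  have "edge_weight_between \<mu> V1 V2 \<le> vol \<mu> V1"
    unfolding edge_weight_between_def vol_def by (intro sum_mono sum_weight_le assms)
  moreover have "edge_weight_between \<mu> V1 V2 = (\<Sum>y\<in>V2. \<Sum>x\<in>V1. \<mu> y x)"
    unfolding edge_weight_between_def by (subst sum.swap) (simp add: weight_sym)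
  then have "edge_weight_between \<mu> V1 V2 \<le> vol \<mu> V2"
    unfolding vol_def by (simp only:) (intro sum_mono sum_weight_le assms)
  ultimately show "2 * edge_weight_between \<mu> V1 V2 / (vol \<mu> V1 + vol \<mu> V2) \<le> 1"
    using vol_nonneg[of V1] vol_nonneg[of V2] by (auto simp: divide_le_eq_1)
  show "0 \<le> 2 * edge_weight_between \<mu> V1 V2 / (vol \<mu> V1 + vol \<mu> V2)"
    using vol_nonneg[of V1] vol_nonneg[of V2]
    by (simp add: edge_weight_between_def sum_nonneg weight_nonneg)
qed

lemma infinite_Compl: "finite (A :: 'v set) \<Longrightarrow> infinite (- A)"
  using infinite_vertices by simp

lemma cheeger_inf_limit:
  assumes "exhaustion K"
  shows "(\<lambda>n. cheeger \<mu> (- K n)) \<longlonglongrightarrow> cheeger_inf \<mu>"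
  unfolding cheeger_inf_def
proof (rule exhaustion_limit_THE[OF assms, where G = "\<lambda>A. cheeger \<mu> (- A)"],
    rule exhaustion_limit_exists[OF exhaustion_exists, where G = "\<lambda>A. cheeger \<mu> (- A)" and M = 1])
  let ?S = "\<lambda>\<Omega>. {boundary_weight \<mu> U / vol \<mu> U | U. U \<noteq> {} \<and> U \<subseteq> \<Omega> \<and> finite U}"
  have bdd: "bdd_below (?S \<Omega>)" for \<Omega>
    using cheeger_ratio_bounds(1) by (auto intro!: bdd_belowI)
  have mem: "\<exists>r \<le> 1. r \<in> ?S (- A)" if A: "finite A" for A
  proof -
    have "- A \<noteq> {}" using infinite_Compl[OF A] by auto
    then obtain x where "x \<notin> A" by blast
    then have "boundary_weight \<mu> {x} / vol \<mu> {x} \<in> ?S (- A)" by blast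
    with cheeger_ratio_bounds(2) show ?thesis by blast
  qed
  show "cheeger \<mu> (- A) \<le> cheeger \<mu> (- B)" if "finite A" "finite B" "A \<subseteq> B" for A B
    unfolding cheeger_def
  proof (rule cInf_superset_mono[OF _ bdd])
    show "?S (- B) \<noteq> {}" using mem[OF \<open>finite B\<close>] by (metis (no_types, lifting) empty_iff)
    show "?S (- B) \<subseteq> ?S (- A)"
      using \<open>A \<subseteq> B\<close> by blast
  qed
  show "cheeger \<mu> (- A) \<le> 1" if A: "finite A" for A
  proof -
    obtain r where r: "r \<le> 1" "r \<in> ?S (- A)" using mem[OF A] by (elim exE conjE)
    have "cheeger \<mu> (- A) \<le> r"
      unfolding cheeger_def by (rule cInf_lower[OF r(2) bdd])
    then show ?thesis using r(1) by simp
  qed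
qed

lemma dual_cheeger_inf_limit:
  assumes "exhaustion K"
  shows "(\<lambda>n. dual_cheeger \<mu> (- K n)) \<longlonglongrightarrow> dual_cheeger_inf \<mu>"
  unfolding dual_cheeger_inf_def
proof (rule exhaustion_limit_THE[OF assms, where G = "\<lambda>A. dual_cheeger \<mu> (- A)"])
  let ?S = "\<lambda>\<Omega>. {2 * edge_weight_between \<mu> V1 V2 / (vol \<mu> V1 + vol \<mu> V2) | V1 V2.
            V1 \<noteq> {} \<and> V2 \<noteq> {} \<and> finite V1 \<and> finite V2 \<and>
            V1 \<subseteq> \<Omega> \<and> V2 \<subseteq> \<Omega> \<and> V1 \<inter> V2 = {}}"
  have bdd: "bdd_above (?S \<Omega>)" for \<Omega>
  proof (rule bdd_aboveI)
    fix r assume "r \<in> ?S \<Omega>"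
    then obtain V1 V2 where "finite V1" "finite V2"
      and r: "r = 2 * edge_weight_between \<mu> V1 V2 / (vol \<mu> V1 + vol \<mu> V2)"
      by (elim CollectE exE conjE)
    then show "r \<le> 1" using dual_cheeger_ratio_bounds(2) by simp
  qed
  have mem: "\<exists>r \<ge> 0. r \<in> ?S (- A)" if A: "finite A" for A
  proof -
    have "- A \<noteq> {}" using infinite_Compl[OF A] by auto
    then obtain x where x: "x \<in> - A" by blast
    have "infinite (- insert x A)" by (rule infinite_Compl) (use A in simp)
    then have "- insert x A \<noteq> {}" by (metis finite.emptyI)
    then obtain y where y: "y \<in> - insert x A" by blast
    let ?r = "2 * edge_weight_between \<mu> {x} {y} / (vol \<mu> {x} + vol \<mu> {y})"
    have "?r \<in> ?S (- A)"
      by (intro CollectI exI[of _ "{x}"] exI[of _ "{y}"] conjI refl) (use x y in auto)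
    moreover have "0 \<le> ?r" by (rule dual_cheeger_ratio_bounds(1)) simp_all
    ultimately show ?thesis by (intro exI conjI)
  qed
  have "\<exists>l. \<forall>K. exhaustion K \<longrightarrow> (\<lambda>n. - dual_cheeger \<mu> (- K n)) \<longlonglongrightarrow> l"
  proof (rule exhaustion_limit_exists[OF exhaustion_exists, where G = "\<lambda>A. - dual_cheeger \<mu> (- A)" and M = 0])
    show "- dual_cheeger \<mu> (- A) \<le> - dual_cheeger \<mu> (- B)"
      if "finite A" "finite B" "A \<subseteq> B" for A B
      unfolding dual_cheeger_def neg_le_iff_le
    proof (rule cSup_subset_mono[OF _ bdd])
      show "?S (- B) \<noteq> {}" using mem[OF \<open>finite B\<close>] by (metis (no_types, lifting) empty_iff)
      show "?S (- B) \<subseteq> ?S (- A)"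
      proof
        fix r assume "r \<in> ?S (- B)"
        then obtain V1 V2 where
          r: "r = 2 * edge_weight_between \<mu> V1 V2 / (vol \<mu> V1 + vol \<mu> V2)"
            and V: "V1 \<noteq> {}" "V2 \<noteq> {}" "finite V1" "finite V2" "V1 \<subseteq> - B" "V2 \<subseteq> - B" "V1 \<inter> V2 = {}"
          by (elim CollectE exE conjE)
        moreover from V \<open>A \<subseteq> B\<close> have "V1 \<subseteq> - A" "V2 \<subseteq> - A" by auto
        ultimately show "r \<in> ?S (- A)" by (intro CollectI exI conjI)
      qed
    qed
    show "- dual_cheeger \<mu> (- A) \<le> 0" if A: "finite A" for A
    proof -
      obtain r where r: "0 \<le> r" "r \<in> ?S (- A)" using mem[OF A] by (elim exE conjE)
      have "r \<le> dual_cheeger \<mu> (- A)"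
        unfolding dual_cheeger_def by (rule cSup_upper[OF r(2) bdd])
      then show ?thesis using r(1) by simp
    qed
  qed
  then obtain l where l: "\<And>K. exhaustion K \<Longrightarrow> (\<lambda>n. - dual_cheeger \<mu> (- K n)) \<longlonglongrightarrow> l"
    by blast
  have "(\<lambda>n. dual_cheeger \<mu> (- K n)) \<longlonglongrightarrow> - l" if "exhaustion K" for K
    using tendsto_minus[OF l[OF that]] by simp
  then show "\<exists>l. \<forall>K. exhaustion K \<longrightarrow> (\<lambda>n. dual_cheeger \<mu> (- K n)) \<longlonglongrightarrow> l"
    by blast
qed

end

end

theory Submission
  imports Defs
begin

text \<open>
  For a finite set \<open>U\<close> the number \<open>1 - |\<partial>U| / vol(U)\<close> is the fraction \<open>|E(U,U)| / vol(U)\<close> of the volume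
  that is carried by edges inside \<open>U\<close>. Hence \<open>h\<^sub>\<infinity> = 1\<close> says that, for every \<open>e > 0\<close>, this fraction
  is at most \<open>e\<close> for all finite sets outside a suitable finite set \<open>K\<close>
  (\<open>interior_small e K\<close>, \<open>cheeger_inf_eq_1_iff\<close>).

  The two Cheeger constants control each other (\<open>dual_cheeger_bounds\<close>). Edges between disjoint sets
  \<open>V1\<close>, \<open>V2\<close> are inner edges of \<open>V1 \<union> V2\<close>, which gives \<open>dual h \<le> 1 - h\<close>. Conversely, in the absence
  of loops every finite set can be cut into two parts such that at least half of the inner weight
  crosses the cut, which gives \<open>1 - h \<le> 2 dual h\<close>. Both inequalities pass to the limit, and so
  \<open>dual h\<^sub>\<infinity> = 0\<close> if and only if \<open>h\<^sub>\<infinity> = 1\<close>.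

  For the spectrum write \<open>\<Delta> = 1 - P\<close>. If \<open>interior_small e K\<close> holds, then \<open>\<langle>P 1\<^sub>U, 1\<^sub>U\<rangle> \<le> e |1\<^sub>U|\<^sup>2\<close> for
  the finite sets \<open>U\<close> outside \<open>K\<close>; decomposing \<open>f\<^sup>2\<close> into level sets (\<open>sum_min_le\<close>) and applying the
  Cauchy-Schwarz inequality extends this to \<open>|\<langle>P f, f\<rangle>| \<le> sqrt (2 e) |f|\<^sup>2\<close> for all \<open>f\<close> that vanish on
  \<open>K\<close> (\<open>transition_form_bound\<close>). So if \<open>h\<^sub>\<infinity> = 1\<close>, the form of \<open>P\<close> is arbitrarily small on
  subspaces of finite codimension. That is compactness of \<open>P\<close>, and as for every compact self-adjoint
  operator on an infinite-dimensional space, the essential spectrum of \<open>P\<close> is \<open>{0}\<close>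
  (\<open>essential_spectrum_single\<close>).

  Conversely, let the essential spectrum of \<open>\<Delta>\<close> be \<open>{1}\<close>. Then the part of the spectrum in
  \<open>[0, 1 - e/2]\<close> consists of finitely many eigenvalues of finite multiplicity, and on the
  orthogonal complement of their eigenvectors \<open>\<langle>P f, f\<rangle> \<le> e/2 |f|\<^sup>2\<close>
  (\<open>form_bound_of_essential_spectrum\<close>). If \<open>interior_small e K\<close> failed for all finite \<open>K\<close>, there would
  be infinitely many finite sets without edges between them whose inner weight exceeds \<open>e\<close> times
  their volume (\<open>far_apart_sequence\<close>). On the span of their indicator functions
  \<open>\<langle>P f, f\<rangle> \<ge> e |f|\<^sup>2\<close>, and this infinite-dimensional space meets every subspace of finite codimension
  outside \<open>0\<close>: a contradiction.

  Spectral theory enters through the principle \<open>form_lower_bound_improve\<close>: the infimum of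
  \<open>\<langle>T f, f\<rangle>\<close> over the unit vectors of a nonzero invariant subspace is a number \<open>m\<close> such that \<open>T - m\<close> is not
  bounded below on this subspace. It yields the resolvent bound (\<open>norm_ge_spectral_gap\<close>) and the gap
  off the kernel (\<open>bounded_below_off_kernel\<close>). Together with \<open>bounded_below_finite_codim\<close>, which passes from
  subspaces of finite codimension to larger ones, these give the two theorems on essential spectra.
\<close>

section \<open>Self-adjoint operators that are bounded below\<close>

definition selfadjoint :: "('a::real_inner \<Rightarrow> 'a) \<Rightarrow> bool" where
  "selfadjoint T \<longleftrightarrow> bounded_linear T \<and> (\<forall>f g. T f \<bullet> g = f \<bullet> T g)"

abbreviation shift :: "('a::real_vector \<Rightarrow> 'a) \<Rightarrow> real \<Rightarrow> 'a \<Rightarrow> 'a" where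
  "shift T t \<equiv> (\<lambda>f. T f - t *\<^sub>R f)"

definition bounded_below_on :: "'a::real_normed_vector set \<Rightarrow> ('a \<Rightarrow> 'a) \<Rightarrow> bool" where
  "bounded_below_on W D \<longleftrightarrow> (\<exists>c>0. \<forall>f\<in>W. c * norm f \<le> norm (D f))"

lemma selfadjointD:
  assumes "selfadjoint T"
  shows "bounded_linear T" "T f \<bullet> g = f \<bullet> T g"
  using assms by (auto simp: selfadjoint_def)

lemma selfadjoint_shift:
  assumes "selfadjoint T"
  shows "selfadjoint (shift T t)"
proof -
  have "bounded_linear (shift T t)"
    by (intro bounded_linear_sub selfadjointD(1)[OF assms] bounded_linear_scaleR_right)
  moreover have "shift T t f \<bullet> g = f \<bullet> shift T t g" for f g
    by (simp add: inner_diff selfadjointD(2)[OF assms])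
  ultimately show ?thesis by (simp add: selfadjoint_def)
qed

lemma selfadjoint_square:
  assumes "selfadjoint T"
  shows "selfadjoint (\<lambda>f. T (T f))"
  using bounded_linear_compose[OF selfadjointD(1) selfadjointD(1), OF assms assms]
  by (simp add: selfadjoint_def selfadjointD(2)[OF assms])

lemma mem_orthogonal_comp: "f \<in> B\<^sup>\<bottom> \<longleftrightarrow> (\<forall>b\<in>B. b \<bullet> f = 0)"
  by (auto simp: orthogonal_comp_def orthogonal_def)

lemma closed_orthogonal_comp: "closed (B\<^sup>\<bottom>)"
proof -
  have "B\<^sup>\<bottom> = (\<Inter>b\<in>B. {f. b \<bullet> f = 0})"
    by (auto simp: mem_orthogonal_comp)
  moreover have "closed {f. b \<bullet> f = 0}" for b :: 'a
    by (intro closed_Collect_eq continuous_intros)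
  ultimately show ?thesis by auto
qed

lemma subspace_closure:
  fixes S :: "'a::real_normed_vector set"
  assumes "subspace S"
  shows "subspace (closure S)"
  unfolding subspace_def
proof (intro conjI ballI allI)
  show "0 \<in> closure S" using subspace_0[OF assms] closure_subset by blast
  show "x + y \<in> closure S" if x: "x \<in> closure S" and y: "y \<in> closure S" for x y
  proof -
    obtain u where u: "\<And>n. u n \<in> S" "u \<longlonglongrightarrow> x" using x closure_sequential by blast
    obtain v where v: "\<And>n. v n \<in> S" "v \<longlonglongrightarrow> y" using y closure_sequential by blast
    have "u n + v n \<in> S" for n using u(1) v(1) assms by (simp add: subspace_add)
    with tendsto_add[OF u(2) v(2)] show ?thesis
      unfolding closure_sequential by (intro exI[of _ "\<lambda>n. u n + v n"]) auto
  qed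
  show "c *\<^sub>R x \<in> closure S" if x: "x \<in> closure S" for c x
  proof -
    obtain u where u: "\<And>n. u n \<in> S" "u \<longlonglongrightarrow> x" using x closure_sequential by blast
    have "c *\<^sub>R u n \<in> S" for n using u(1) assms by (simp add: subspace_scale)
    with tendsto_scaleR[OF tendsto_const u(2)] show ?thesis
      unfolding closure_sequential by (intro exI[of _ "\<lambda>n. c *\<^sub>R u n"]) auto
  qed
qed

lemma bounded_below_on_compose:
  assumes "bounded_below_on UNIV D1" "bounded_below_on UNIV D2"
  shows "bounded_below_on UNIV (\<lambda>f. D1 (D2 f))"
proof -
  obtain c1 where c1: "c1 > 0" "\<And>f. c1 * norm f \<le> norm (D1 f)"
    using assms(1) by (auto simp: bounded_below_on_def)
  obtain c2 where c2: "c2 > 0" "\<And>f. c2 * norm f \<le> norm (D2 f)"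
    using assms(2) by (auto simp: bounded_below_on_def)
  have "c1 * c2 * norm f \<le> norm (D1 (D2 f))" for f
  proof -
    have "c1 * (c2 * norm f) \<le> c1 * norm (D2 f)"
      using c1(1) c2(2) by (intro mult_left_mono) auto
    then show ?thesis using c1(2)[of "D2 f"] by simp
  qed
  then show ?thesis
    unfolding bounded_below_on_def using c1(1) c2(1) by (intro exI[of _ "c1 * c2"]) auto
qed

text \<open>
  Evaluating the nonnegative form at the gradient step \<open>f - A f / K\<close> bounds \<open>|A f|\<^sup>2\<close>:
  a nonnegative form that is small at \<open>f\<close> forces \<open>A f\<close> to be small.
\<close>

lemma nonneg_form_norm_bound:
  assumes A: "selfadjoint A" and W: "subspace W" "\<And>f. f \<in> W \<Longrightarrow> A f \<in> W"
    and pos: "\<And>f. f \<in> W \<Longrightarrow> 0 \<le> A f \<bullet> f"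
    and K: "K > 0" "\<And>f. norm (A f) \<le> K * norm f"
    and f: "f \<in> W"
  shows "(norm (A f))\<^sup>2 \<le> K * (A f \<bullet> f)"
proof -
  interpret bounded_linear A using A by (rule selfadjointD)
  define g where "g = f - (1 / K) *\<^sub>R A f"
  have "g \<in> W"
    unfolding g_def using W f by (simp add: subspace_diff subspace_scale)
  then have "0 \<le> A g \<bullet> g" by (rule pos)
  also have "A g \<bullet> g = A f \<bullet> f - 2 / K * (A f \<bullet> A f) + 1 / K\<^sup>2 * (A (A f) \<bullet> A f)"
    unfolding g_def
    using selfadjointD(2)[OF A, of "A f" f] inner_commute[of f "A (A f)"]
    by (simp add: diff scaleR inner_diff power2_eq_square diff_divide_distrib)
  also have "A (A f) \<bullet> A f \<le> K * (norm (A f))\<^sup>2"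
  proof -
    have "A (A f) \<bullet> A f \<le> norm (A (A f)) * norm (A f)" by (rule norm_cauchy_schwarz)
    also have "\<dots> \<le> (K * norm (A f)) * norm (A f)" by (intro mult_right_mono K) simp
    finally show ?thesis by (simp add: power2_eq_square)
  qed
  finally have "0 \<le> A f \<bullet> f - 2 / K * (norm (A f))\<^sup>2 + 1 / K\<^sup>2 * (K * (norm (A f))\<^sup>2)"
    using K(1) by (simp add: power2_norm_eq_inner divide_right_mono)
  then show ?thesis using K(1) by (simp add: field_simps power2_eq_square)
qed

text \<open>
  Let \<open>m\<close> be the infimum of the Rayleigh quotient on \<open>W\<close>. The form of \<open>T - m\<close> is nonnegative on \<open>W\<close>, so
  \<open>nonneg_form_norm_bound\<close> makes \<open>(T - m) f\<close> small on unit vectors that almost attain the infimum. Hence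
  \<open>T - m\<close> is not bounded below on \<open>W\<close>, and \<open>m\<close> cannot lie in \<open>[a, b)\<close>.
\<close>

lemma form_lower_bound_improve:
  assumes T: "selfadjoint T" and W: "subspace W" "\<And>f. f \<in> W \<Longrightarrow> T f \<in> W"
    and a: "\<And>f. f \<in> W \<Longrightarrow> a * (f \<bullet> f) \<le> T f \<bullet> f"
    and bb: "\<And>s. a \<le> s \<Longrightarrow> s < b \<Longrightarrow> bounded_below_on W (shift T s)"
    and f: "f \<in> W"
  shows "b * (f \<bullet> f) \<le> T f \<bullet> f"
proof (rule ccontr)
  assume neg: "\<not> ?thesis"
  define Q where "Q = (\<lambda>f. (T f \<bullet> f) / (f \<bullet> f)) ` (W - {0})"
  define m where "m = Inf Q"
  have f0: "f \<noteq> 0" using neg by (auto simp: linear_0[OF bounded_linear.linear[OF selfadjointD(1)[OF T]]])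
  have low: "a \<le> q" if q: "q \<in> Q" for q
  proof -
    obtain g where g: "g \<in> W" "g \<noteq> 0" "q = (T g \<bullet> g) / (g \<bullet> g)"
      using q unfolding Q_def by blast
    then show ?thesis using a[OF g(1)] by (simp add: pos_le_divide_eq)
  qed
  then have bdd: "bdd_below Q" by (rule bdd_belowI)
  have ne: "Q \<noteq> {}" using f f0 by (auto simp: Q_def)
  have "a \<le> m" unfolding m_def by (rule cInf_greatest[OF ne low])
  moreover have "m < b"
  proof -
    have "m \<le> (T f \<bullet> f) / (f \<bullet> f)"
      unfolding m_def using bdd f f0 by (intro cInf_lower) (auto simp: Q_def)
    also have "\<dots> < b" using neg f0 by (simp add: pos_divide_less_eq)
    finally show ?thesis .
  qed
  ultimately obtain c where c: "c > 0" "\<And>g. g \<in> W \<Longrightarrow> c * norm g \<le> norm (shift T m g)"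
    using bb[of m] by (auto simp: bounded_below_on_def)
  have A: "selfadjoint (shift T m)" by (rule selfadjoint_shift[OF T])
  obtain K where K: "K > 0" "\<And>g. norm (shift T m g) \<le> K * norm g"
    using bounded_linear.pos_bounded[OF selfadjointD(1)[OF A]] by (auto simp: mult.commute)
  have form: "m * (g \<bullet> g) \<le> T g \<bullet> g" if g: "g \<in> W" for g
  proof (cases "g = 0")
    case False
    then have "m \<le> (T g \<bullet> g) / (g \<bullet> g)"
      unfolding m_def using bdd g by (intro cInf_lower) (auto simp: Q_def)
    then show ?thesis using False by (simp add: pos_le_divide_eq)
  qed (simp add: linear_0[OF bounded_linear.linear[OF selfadjointD(1)[OF T]]])
  \<comment> \<open>If T - m were bounded below by c, then all Rayleigh quotients would exceed their infimum m
    by a fixed amount.\<close>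
  have "m + c\<^sup>2 / K \<le> q" if q: "q \<in> Q" for q
  proof -
    obtain g where g: "g \<in> W" "g \<noteq> 0" "q = (T g \<bullet> g) / (g \<bullet> g)"
      using q unfolding Q_def by blast
    have "(c * norm g)\<^sup>2 \<le> (norm (shift T m g))\<^sup>2"
      using c g(1) by (intro power_mono) auto
    also have "\<dots> \<le> K * (shift T m g \<bullet> g)"
      using W g(1) K form
      by (intro nonneg_form_norm_bound[OF A W(1)]) (auto simp: inner_diff subspace_diff subspace_scale)
    finally have "c\<^sup>2 * (g \<bullet> g) \<le> K * (T g \<bullet> g - m * (g \<bullet> g))"
      by (simp add: power_mult_distrib power2_norm_eq_inner inner_diff)
    then have "(c\<^sup>2 / K) * (g \<bullet> g) \<le> T g \<bullet> g - m * (g \<bullet> g)"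
      using K(1) by (simp add: field_simps)
    then show ?thesis using g(2) by (simp add: g(3) pos_le_divide_eq algebra_simps)
  qed
  then have "m + c\<^sup>2 / K \<le> m" unfolding m_def by (rule cInf_greatest[OF ne])
  moreover have "c\<^sup>2 / K > 0" using c(1) K(1) by simp
  ultimately show False by simp
qed

text \<open>
  This is the bound by the inverse distance to the spectrum for the inverse of a self-adjoint operator.
  It is \<open>form_lower_bound_improve\<close> for \<open>S\<^sup>2\<close>, since \<open>S\<^sup>2 - s = (S - sqrt s) (S + sqrt s)\<close> for \<open>s \<ge> 0\<close>.
\<close>

lemma norm_ge_spectral_gap:
  assumes S: "selfadjoint S" and "0 \<le> \<delta>"
    and bb: "\<And>x. \<bar>x\<bar> < \<delta> \<Longrightarrow> bounded_below_on UNIV (shift S x)"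
  shows "\<delta> * norm f \<le> norm (S f)"
proof -
  interpret bounded_linear S using S by (rule selfadjointD)
  have "\<delta>\<^sup>2 * (f \<bullet> f) \<le> S (S f) \<bullet> f"
  proof (rule form_lower_bound_improve[OF selfadjoint_square[OF S] subspace_UNIV])
    show "0 * (g \<bullet> g) \<le> S (S g) \<bullet> g" for g
      using selfadjointD(2)[OF S, of "S g" g] by simp
    fix s :: real assume s: "0 \<le> s" "s < \<delta>\<^sup>2"
    then have "sqrt s < \<delta>" using \<open>0 \<le> \<delta>\<close> real_sqrt_less_iff[of s "\<delta>\<^sup>2"] by simp
    then have "bounded_below_on UNIV (\<lambda>g. shift S (sqrt s) (shift S (- sqrt s) g))"
      using s
      by (intro bounded_below_on_compose[where ?D1.0 = "shift S (sqrt s)" and ?D2.0 = "shift S (- sqrt s)"] bb) auto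
    also have "(\<lambda>g. shift S (sqrt s) (shift S (- sqrt s) g)) = shift (\<lambda>g. S (S g)) s"
      using s by (auto simp: diff add scaleR algebra_simps)
    finally show "bounded_below_on UNIV (shift (\<lambda>g. S (S g)) s)" .
  qed auto
  then have "(\<delta> * norm f)\<^sup>2 \<le> (norm (S f))\<^sup>2"
    using selfadjointD(2)[OF S, of "S f" f] by (simp add: power_mult_distrib power2_norm_eq_inner)
  then show ?thesis by (rule power2_le_imp_le) simp
qed

text \<open>
  For small \<open>\<alpha> > 0\<close> the map \<open>g \<mapsto> g - \<alpha> (D\<^sup>2 g - h)\<close> is a contraction of \<open>R\<close>, because
  \<open>\<langle>D\<^sup>2 u, u\<rangle> = |D u|\<^sup>2\<close> is at least \<open>c\<^sup>2 |u|\<^sup>2\<close>; its fixed point solves the equation. The subspace \<open>R\<close> is the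
  whole space when an inverse of \<open>D\<close> is wanted, and the closure of the range of \<open>D\<close> when \<open>D\<close> has a kernel.
\<close>

lemma solve_square:
  fixes D :: "'a::{real_inner,complete_space} \<Rightarrow> 'a"
  assumes D: "selfadjoint D" and R: "subspace R" "closed R" "\<And>g. g \<in> R \<Longrightarrow> D g \<in> R"
    and c: "c > 0" "\<And>g. g \<in> R \<Longrightarrow> c * norm g \<le> norm (D g)"
    and h: "h \<in> R"
  shows "\<exists>g\<in>R. D (D g) = h"
proof -
  interpret bounded_linear D using D by (rule selfadjointD)
  obtain K where K: "K > 0" "\<And>g. norm (D g) \<le> K * norm g"
    using pos_bounded by (auto simp: mult.commute)
  define \<alpha> where "\<alpha> = 1 / K\<^sup>2"
  have \<alpha>: "\<alpha> > 0" using K(1) by (simp add: \<alpha>_def)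
  define q where "q = sqrt (max 0 (1 - \<alpha> * c\<^sup>2))"
  have q: "0 \<le> q" by (simp add: q_def)
  define \<Phi> where "\<Phi> g = g - \<alpha> *\<^sub>R (D (D g) - h)" for g
  have contr: "norm (u - \<alpha> *\<^sub>R D (D u)) \<le> q * norm u" if u: "u \<in> R" for u
  proof -
    have "(norm (u - \<alpha> *\<^sub>R D (D u)))\<^sup>2
        = (norm u)\<^sup>2 - 2 * \<alpha> * (norm (D u))\<^sup>2 + \<alpha>\<^sup>2 * (norm (D (D u)))\<^sup>2"
      unfolding power2_norm_eq_inner
      using selfadjointD(2)[OF D, of "D u" u] inner_commute[of u "D (D u)"]
      by (simp add: inner_diff power2_eq_square algebra_simps)
    moreover have "\<alpha>\<^sup>2 * (norm (D (D u)))\<^sup>2 \<le> \<alpha>\<^sup>2 * (K * norm (D u))\<^sup>2"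
      using K by (intro mult_left_mono power_mono) auto
    moreover have "\<alpha>\<^sup>2 * (K * norm (D u))\<^sup>2 = \<alpha> * (norm (D u))\<^sup>2"
      using K(1) by (simp add: \<alpha>_def power2_eq_square)
    ultimately have "(norm (u - \<alpha> *\<^sub>R D (D u)))\<^sup>2 \<le> (norm u)\<^sup>2 - \<alpha> * (norm (D u))\<^sup>2"
      by linarith
    also have "\<dots> \<le> (norm u)\<^sup>2 - \<alpha> * (c * norm u)\<^sup>2"
      using \<alpha> c u by (intro diff_left_mono mult_left_mono power_mono) auto
    also have "\<dots> \<le> max 0 (1 - \<alpha> * c\<^sup>2) * (norm u)\<^sup>2"
      using mult_right_mono[of "1 - \<alpha> * c\<^sup>2" "max 0 (1 - \<alpha> * c\<^sup>2)" "(norm u)\<^sup>2"]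
      by (simp add: power_mult_distrib algebra_simps)
    also have "\<dots> = (q * norm u)\<^sup>2" by (simp add: q_def power_mult_distrib)
    finally show ?thesis by (rule power2_le_imp_le) (intro mult_nonneg_nonneg q norm_ge_zero)
  qed
  have "\<exists>!g\<in>R. \<Phi> g = g"
  proof (rule Banach_fix)
    show "complete R" using R(2) by (simp add: complete_eq_closed)
    show "R \<noteq> {}" using h by auto
    show "0 \<le> q" by (rule q)
    show "q < 1" using \<alpha> c(1) by (simp add: q_def max_def)
    show "\<Phi> ` R \<subseteq> R"
      using R h by (auto simp: \<Phi>_def subspace_diff subspace_scale)
    show "dist (\<Phi> x) (\<Phi> y) \<le> q * dist x y" if "x \<in> R" "y \<in> R" for x y
      using contr[of "x - y"] that R(1)
      by (simp add: dist_norm \<Phi>_def subspace_diff diff scaleR_diff_right algebra_simps)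
  qed
  then obtain g where "g \<in> R" "\<Phi> g = g" by blast
  then show ?thesis using \<alpha> by (auto simp: \<Phi>_def)
qed

lemma surj_if_bounded_below:
  fixes D :: "'a::{real_inner,complete_space} \<Rightarrow> 'a"
  assumes "selfadjoint D" "bounded_below_on UNIV D"
  shows "surj D"
proof -
  obtain c where "c > 0" "\<And>g. c * norm g \<le> norm (D g)"
    using assms(2) by (auto simp: bounded_below_on_def)
  then have "\<exists>g\<in>UNIV. D (D g) = h" for h
    by (intro solve_square[OF assms(1)]) auto
  then show ?thesis unfolding surj_def by metis
qed

text \<open>
  If \<open>0\<close> is at most an isolated point of the spectrum, then \<open>D\<close> has a gap off its kernel. The polynomial
  \<open>y (y - \<delta>\<^sup>2)\<close> is nonnegative at the squares of all spectral points, which yields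
  \<open>|D\<^sup>2 g| \<ge> \<delta> |D g|\<close>, a lower bound for \<open>D\<close> on its range and then on the closure of its range. By
  \<open>solve_square\<close> every \<open>f\<close> is a vector of the form \<open>D g\<close> plus a vector of the kernel; for \<open>f\<close>
  orthogonal to the kernel the second part is zero.
\<close>

lemma bounded_below_off_kernel:
  fixes D :: "'a::{real_inner,complete_space} \<Rightarrow> 'a"
  assumes D: "selfadjoint D" and \<delta>: "\<delta> > 0"
    and bb: "\<And>x. 0 < \<bar>x\<bar> \<Longrightarrow> \<bar>x\<bar> < \<delta> \<Longrightarrow> bounded_below_on UNIV (shift D x)"
    and f: "f \<in> {g. D g = 0}\<^sup>\<bottom>"
  shows "\<delta> * norm f \<le> norm (D f)"
proof -
  interpret bounded_linear D using D by (rule selfadjointD)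
  define c where "c = \<delta>\<^sup>2"
  have c: "c > 0" using \<delta> by (simp add: c_def)
  have D2: "norm (D (D g)) \<ge> \<delta> * norm (D g)" for g
  proof -
    \<comment> \<open>Since y (y - c) = (y - c/2)^2 - (c/2)^2, the polynomial is handled through the distance c/2
      from the midpoint c/2 to the spectrum of the square of D.\<close>
    have "c / 2 * norm g \<le> norm (shift (\<lambda>g. D (D g)) (c / 2) g)"
    proof (rule norm_ge_spectral_gap[OF selfadjoint_shift[OF selfadjoint_square[OF D]]])
      fix x :: real assume x: "\<bar>x\<bar> < c / 2"
      define y where "y = sqrt (c / 2 + x)"
      have "c / 2 + x > 0" "c / 2 + x < c" using x by auto
      then have "y > 0" "y < \<delta>" "y * y = c / 2 + x"
        using real_sqrt_less_iff[of "c / 2 + x" c] \<delta> by (auto simp: y_def c_def)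
      then have "bounded_below_on UNIV (\<lambda>g. shift D y (shift D (- y) g))"
        by (intro bounded_below_on_compose[where ?D1.0 = "shift D y" and ?D2.0 = "shift D (- y)"] bb) auto
      also have "(\<lambda>g. shift D y (shift D (- y) g)) = shift (shift (\<lambda>g. D (D g)) (c / 2)) x"
        using \<open>y * y = c / 2 + x\<close>
        by (auto simp: diff add scaleR algebra_simps)
      finally show "bounded_below_on UNIV (shift (shift (\<lambda>g. D (D g)) (c / 2)) x)" .
    qed (use c in auto)
    then have "(c / 2 * norm g)\<^sup>2 \<le> (norm (shift (\<lambda>g. D (D g)) (c / 2) g))\<^sup>2"
      using c by (intro power_mono) auto
    also have "\<dots> = (norm (D (D g)))\<^sup>2 - c * (norm (D g))\<^sup>2 + (c / 2 * norm g)\<^sup>2"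
      unfolding power_mult_distrib power2_norm_eq_inner
      by (simp add: inner_diff inner_commute[of g "D (D g)"]
          selfadjointD(2)[OF D, of "D g" g] power2_eq_square algebra_simps)
    finally have "(\<delta> * norm (D g))\<^sup>2 \<le> (norm (D (D g)))\<^sup>2"
      by (simp add: c_def power_mult_distrib)
    then show ?thesis by (rule power2_le_imp_le) simp
  qed
  define R where "R = closure (range D)"
  have subR: "subspace R"
    unfolding R_def by (intro subspace_closure linear_subspace_image linear subspace_UNIV)
  have R: "\<delta> * norm g \<le> norm (D g)" if "g \<in> R" for g
  proof -
    have "closed {g. \<delta> * norm g \<le> norm (D g)}"
      by (intro closed_Collect_le continuous_intros continuous_on)
    moreover have "range D \<subseteq> {g. \<delta> * norm g \<le> norm (D g)}" using D2 by auto
    ultimately have "R \<subseteq> {g. \<delta> * norm g \<le> norm (D g)}"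
      unfolding R_def by (rule closure_minimal[rotated])
    then show ?thesis using that by auto
  qed
  have mem: "D g \<in> R" for g
    unfolding R_def by (rule subsetD[OF closure_subset]) simp
  obtain g where g: "D (D g) = D f"
    using solve_square[OF D subR _ mem \<delta> R mem, of f] by (auto simp: R_def)
  have k: "D (f - D g) = 0" using g by (simp add: diff)
  have "(f - D g) \<bullet> (f - D g) = (f - D g) \<bullet> f - (f - D g) \<bullet> D g"
    by (rule inner_diff_right)
  also have "(f - D g) \<bullet> D g = D (f - D g) \<bullet> g" by (rule selfadjointD(2)[OF D, symmetric])
  also have "(f - D g) \<bullet> f - D (f - D g) \<bullet> g = 0" using f k by (simp add: mem_orthogonal_comp)
  finally have "f = D g" by simp
  then show ?thesis using D2[of g] by simp
qed

text \<open>
  An injective operator that is bounded below on a subspace of finite codimension is bounded below.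
  One dimension at a time: the image of the smaller subspace \<open>X\<close> is closed, and for \<open>u \<notin> X\<close> injectivity
  keeps \<open>D u\<close> away from it. So the distance \<open>d\<close> from \<open>D u\<close> to \<open>D ` X\<close> is positive, and it
  controls the component of a vector along \<open>u\<close>.
\<close>

lemma bounded_below_finite_codim:
  fixes D :: "'a::{real_inner,complete_space} \<Rightarrow> 'a"
  assumes D: "bounded_linear D" and W: "subspace W" "closed W"
    and inj: "\<And>f. f \<in> W \<Longrightarrow> D f = 0 \<Longrightarrow> f = 0"
    and B: "finite B" "bounded_below_on (W \<inter> B\<^sup>\<bottom>) D"
  shows "bounded_below_on W D"
  using B
proof (induction B rule: finite_induct)
  case empty
  then show ?case by (simp add: orthogonal_comp_def)
next
  case (insert b B)
  interpret bounded_linear D by (rule D)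
  define X where "X = W \<inter> (insert b B)\<^sup>\<bottom>"
  have X: "subspace X" "closed X"
    using W by (auto simp: X_def closed_orthogonal_comp subspace_orthogonal_comp intro: subspace_inter)
  obtain c where c: "c > 0" "\<And>f. f \<in> X \<Longrightarrow> c * norm f \<le> norm (D f)"
    using insert.prems by (auto simp: bounded_below_on_def X_def)
  have "bounded_below_on (W \<inter> B\<^sup>\<bottom>) D"
  proof (cases "W \<inter> B\<^sup>\<bottom> \<subseteq> X")
    case True
    then show ?thesis using c by (auto simp: bounded_below_on_def)
  next
    case False
    then obtain u0 where u0: "u0 \<in> W" "u0 \<in> B\<^sup>\<bottom>" "u0 \<notin> X" by blast
    then have "b \<bullet> u0 \<noteq> 0" by (auto simp: X_def mem_orthogonal_comp)
    define u where "u = (1 / (b \<bullet> u0)) *\<^sub>R u0"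
    have u: "u \<in> W" "u \<in> B\<^sup>\<bottom>" "b \<bullet> u = 1"
      using u0 \<open>b \<bullet> u0 \<noteq> 0\<close> W by (auto simp: u_def subspace_scale subspace_orthogonal_comp)
    have "D u \<notin> D ` X"
    proof
      assume "D u \<in> D ` X"
      then obtain x where x: "x \<in> X" "D u = D x" by auto
      then have "u - x \<in> W" "D (u - x) = 0" using u W by (auto simp: X_def subspace_diff diff)
      then have "u = x" using inj[of "u - x"] by simp
      then show False using x u by (auto simp: X_def mem_orthogonal_comp)
    qed
    moreover have "closed (D ` X)"
      using complete_isometric_image[OF c(1) X(1) D] c(2) X(2)
      by (auto simp: complete_eq_closed)
    ultimately have "open (- (D ` X))" "D u \<in> - (D ` X)" by auto
    then obtain d where d0: "d > 0" "ball (D u) d \<subseteq> - (D ` X)" by (rule openE)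
    have d: "d \<le> norm (D u - D x)" if "x \<in> X" for x
    proof (rule ccontr)
      assume "\<not> ?thesis"
      then have "D x \<in> ball (D u) d" by (simp add: dist_norm)
      then show False using d0(2) that by blast
    qed
    define C where "C = (1 + norm (D u) / d) / c + norm u / d"
    have C: "C > 0"
      unfolding C_def using c(1) d0(1) by (intro add_pos_nonneg divide_pos_pos) (auto intro: add_pos_nonneg)
    have "norm g \<le> C * norm (D g)" if g: "g \<in> W" "g \<in> B\<^sup>\<bottom>" for g
    proof -
      define l where "l = b \<bullet> g"
      define w where "w = g - l *\<^sub>R u"
      have w: "w \<in> X"
        using g u W
        by (auto simp: X_def w_def l_def mem_orthogonal_comp inner_diff subspace_diff subspace_scale)
      have gw: "g = w + l *\<^sub>R u" by (simp add: w_def)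
      have l: "\<bar>l\<bar> * d \<le> norm (D g)"
      proof (cases "l = 0")
        case False
        have "d \<le> norm (D u - D ((- 1 / l) *\<^sub>R w))"
          using w X(1) by (intro d) (simp add: subspace_scale subspace_neg)
        then have "\<bar>l\<bar> * d \<le> norm (l *\<^sub>R (D u - D ((- 1 / l) *\<^sub>R w)))"
          by (simp add: mult_left_mono)
        also have "l *\<^sub>R (D u - D ((- 1 / l) *\<^sub>R w)) = D g"
          using False by (simp add: gw add scaleR neg scaleR_diff_right scaleR_add_right)
        finally show ?thesis .
      qed simp
      have "c * norm w \<le> norm (D w)" using w by (rule c)
      also have "D w = D g - l *\<^sub>R D u" by (simp add: w_def diff scaleR)
      also have "norm \<dots> \<le> norm (D g) + \<bar>l\<bar> * norm (D u)"
        using norm_triangle_ineq4[of "D g" "l *\<^sub>R D u"] by simp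
      also have "\<dots> \<le> norm (D g) + (norm (D g) / d) * norm (D u)"
        using l d0(1) by (intro add_left_mono mult_right_mono) (auto simp: field_simps)
      finally have "norm w \<le> (1 + norm (D u) / d) / c * norm (D g)"
        using c(1) by (simp add: field_simps)
      moreover have "norm (l *\<^sub>R u) \<le> (norm (D g) / d) * norm u"
        unfolding norm_scaleR using l d0(1) by (intro mult_right_mono) (auto simp: field_simps)
      moreover have "norm g \<le> norm w + norm (l *\<^sub>R u)"
        unfolding gw by (rule norm_triangle_ineq)
      ultimately show ?thesis by (simp add: C_def algebra_simps)
    qed
    then show ?thesis
      unfolding bounded_below_on_def using C
      by (intro exI[of _ "1 / C"]) (auto simp: field_simps)
  qed
  then show ?case by (rule insert.IH)
qed

section \<open>Subspaces of finite codimension\<close>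

text \<open>
  A subspace that meets a subspace of finite codimension only in \<open>0\<close> has finite dimension: dropping one
  constraint \<open>b\<close> from \<open>B\<close> enlarges the intersection by at most one dimension.
\<close>

lemma finite_spanning_set:
  fixes N :: "'a::real_inner set"
  assumes N: "subspace N" and B: "finite B" "N \<inter> B\<^sup>\<bottom> \<subseteq> {0}"
  shows "\<exists>C. finite C \<and> C \<subseteq> N \<and> N \<subseteq> span C"
proof -
  have "\<exists>C. finite C \<and> C \<subseteq> N \<and> N \<subseteq> span C"
    if "finite B" "\<exists>C. finite C \<and> C \<subseteq> N \<and> N \<inter> B\<^sup>\<bottom> \<subseteq> span C" for B
    using that
  proof (induction B rule: finite_induct)
    case empty
    then show ?case by (simp add: orthogonal_comp_def)
  next
    case (insert b B)
    obtain C where C: "finite C" "C \<subseteq> N" "N \<inter> (insert b B)\<^sup>\<bottom> \<subseteq> span C"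
      using insert.prems by blast
    show ?case
    proof (rule insert.IH, cases "N \<inter> B\<^sup>\<bottom> \<subseteq> (insert b B)\<^sup>\<bottom>")
      case True
      then show "\<exists>C. finite C \<and> C \<subseteq> N \<and> N \<inter> B\<^sup>\<bottom> \<subseteq> span C" using C by blast
    next
      case False
      then obtain u where u: "u \<in> N" "u \<in> B\<^sup>\<bottom>" "u \<notin> (insert b B)\<^sup>\<bottom>" by blast
      then have "b \<bullet> u \<noteq> 0" by (auto simp: mem_orthogonal_comp)
      have "g \<in> span (insert u C)" if g: "g \<in> N" "g \<in> B\<^sup>\<bottom>" for g
      proof -
        define l where "l = b \<bullet> g / (b \<bullet> u)"
        have "g - l *\<^sub>R u \<in> N \<inter> (insert b B)\<^sup>\<bottom>"
          using g u N \<open>b \<bullet> u \<noteq> 0\<close>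
          by (auto simp: mem_orthogonal_comp inner_diff l_def subspace_diff subspace_scale)
        then have "g - l *\<^sub>R u \<in> span C" using C by blast
        then show ?thesis unfolding span_insert by auto
      qed
      then show "\<exists>C. finite C \<and> C \<subseteq> N \<and> N \<inter> B\<^sup>\<bottom> \<subseteq> span C"
        using C u by (intro exI[of _ "insert u C"]) auto
    qed
  qed
  then show ?thesis using B by (metis empty_subsetI finite.emptyI span_empty)
qed

lemma infinite_orthogonal_meets_finite_codim:
  fixes S :: "'a::real_inner set"
  assumes S: "infinite S" "pairwise orthogonal S" "0 \<notin> S" and B: "finite B"
  shows "\<exists>f\<in>span S. f \<in> B\<^sup>\<bottom> \<and> f \<noteq> 0"
proof (rule ccontr)
  assume "\<not> ?thesis"
  then have "span S \<inter> B\<^sup>\<bottom> \<subseteq> {0}" by blast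
  then obtain C where C: "finite C" "span S \<subseteq> span C"
    using finite_spanning_set[OF subspace_span B] by blast
  then have "S \<subseteq> span C" using span_superset by blast
  then have "finite S"
    using independent_span_bound[OF C(1) pairwise_orthogonal_independent[OF S(2,3)]] by blast
  with S(1) show False by simp
qed

text \<open>
  Vectors that are orthogonal both for the inner product and for the form of \<open>A\<close> diagonalise the two
  quadratic forms simultaneously.
\<close>

lemma form_lower_bound_on_span:
  fixes A :: "'a::real_inner \<Rightarrow> 'a"
  assumes A: "linear A"
    and orth: "\<And>u v. u \<in> S \<Longrightarrow> v \<in> S \<Longrightarrow> u \<noteq> v \<Longrightarrow> u \<bullet> v = 0 \<and> A u \<bullet> v = 0"
    and diag: "\<And>v. v \<in> S \<Longrightarrow> e * (v \<bullet> v) \<le> A v \<bullet> v"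
    and f: "f \<in> span S"
  shows "e * (f \<bullet> f) \<le> A f \<bullet> f"
proof -
  interpret linear A by (rule A)
  obtain I c where I: "finite I" "I \<subseteq> S" and f: "f = (\<Sum>v\<in>I. c v *\<^sub>R v)"
    using f by (auto simp: span_explicit)
  have diagonal: "(\<Sum>u\<in>I. \<Sum>v\<in>I. c u * (c v * g u v)) = (\<Sum>v\<in>I. (c v)\<^sup>2 * g v v)"
    if g: "\<And>u v. u \<in> I \<Longrightarrow> v \<in> I \<Longrightarrow> u \<noteq> v \<Longrightarrow> g u v = 0" for g :: "'a \<Rightarrow> 'a \<Rightarrow> real"
  proof (rule sum.cong[OF refl])
    fix u assume u: "u \<in> I"
    have "(\<Sum>v\<in>I. c u * (c v * g u v)) = (\<Sum>v\<in>I. if v = u then (c u)\<^sup>2 * g u u else 0)"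
      using g u by (intro sum.cong) (auto simp: power2_eq_square)
    then show "(\<Sum>v\<in>I. c u * (c v * g u v)) = (c u)\<^sup>2 * g u u"
      using u I(1) by simp
  qed
  have expand: "g \<bullet> f = (\<Sum>v\<in>I. c v * (g \<bullet> v))" for g
    by (simp add: f inner_sum_right)
  have Af: "A f = (\<Sum>u\<in>I. c u *\<^sub>R A u)" by (simp add: f sum scale)
  have "f \<bullet> f = (\<Sum>u\<in>I. c u *\<^sub>R u) \<bullet> f" using f by simp
  also have "\<dots> = (\<Sum>u\<in>I. c u * (u \<bullet> f))" by (simp add: inner_sum_left)
  also have "\<dots> = (\<Sum>u\<in>I. \<Sum>v\<in>I. c u * (c v * (u \<bullet> v)))"
    by (simp only: expand sum_distrib_left)
  also have "\<dots> = (\<Sum>v\<in>I. (c v)\<^sup>2 * (v \<bullet> v))"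
    using orth I by (intro diagonal) blast
  finally have ff: "f \<bullet> f = (\<Sum>v\<in>I. (c v)\<^sup>2 * (v \<bullet> v))" .
  have "A f \<bullet> f = (\<Sum>u\<in>I. c u * (A u \<bullet> f))" by (simp add: Af inner_sum_left)
  also have "\<dots> = (\<Sum>u\<in>I. \<Sum>v\<in>I. c u * (c v * (A u \<bullet> v)))"
    by (simp only: expand sum_distrib_left)
  also have "\<dots> = (\<Sum>v\<in>I. (c v)\<^sup>2 * (A v \<bullet> v))"
    using orth I by (intro diagonal) blast
  finally have Aff: "A f \<bullet> f = (\<Sum>v\<in>I. (c v)\<^sup>2 * (A v \<bullet> v))" .
  have "(c v)\<^sup>2 * (e * (v \<bullet> v)) \<le> (c v)\<^sup>2 * (A v \<bullet> v)" if "v \<in> I" for v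
    using diag that I by (intro mult_left_mono) auto
  then show ?thesis
    unfolding ff Aff sum_distrib_left by (intro sum_mono) (simp add: mult_ac)
qed

section \<open>The essential spectrum of a self-adjoint operator\<close>

text \<open>
  For a self-adjoint operator on a complete space this set is the whole spectrum, because an operator
  that is bounded below is then invertible (\<open>surj_if_bounded_below\<close>).
\<close>

definition approximate_spectrum :: "('a::real_normed_vector \<Rightarrow> 'a) \<Rightarrow> real set" where
  "approximate_spectrum T = {t. \<not> bounded_below_on UNIV (shift T t)}"

definition eigenspace :: "('a::real_vector \<Rightarrow> 'a) \<Rightarrow> real \<Rightarrow> 'a set" where
  "eigenspace T t = {f. T f = t *\<^sub>R f}"

definition essential_spectrum :: "('a::real_normed_vector \<Rightarrow> 'a) \<Rightarrow> real set" where
  "essential_spectrum T = approximate_spectrum T -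
     {t. t isolated_in approximate_spectrum T \<and> eigenspace T t \<noteq> {0} \<and>
         (\<exists>C. finite C \<and> C \<subseteq> eigenspace T t \<and> eigenspace T t \<subseteq> span C)}"

lemma subspace_eigenspace:
  assumes "linear T"
  shows "subspace (eigenspace T t)"
proof -
  interpret linear T by (rule assms)
  show ?thesis
    by (auto simp: subspace_def eigenspace_def add scale scaleR_add_right mult.commute)
qed

text \<open>
  The two ways of lying outside the essential spectrum share this consequence. For an isolated eigenvalue,
  \<open>bounded_below_off_kernel\<close> applies and \<open>C\<close> spans the eigenspace. For a point outside the spectrum,
  \<open>C = {}\<close> suffices, because being bounded below is stable under small shifts.
\<close>

lemma outside_essential_spectrum:
  fixes T :: "'a::{real_inner,complete_space} \<Rightarrow> 'a"
  assumes T: "selfadjoint T" and t: "t \<notin> essential_spectrum T"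
  obtains \<delta> C where "\<delta> > 0" "finite C" "C \<subseteq> eigenspace T t"
    "\<And>f. f \<in> C\<^sup>\<bottom> \<Longrightarrow> \<delta> * norm f \<le> norm (shift T t f)"
    "\<And>s. s \<noteq> t \<Longrightarrow> \<bar>s - t\<bar> < \<delta> \<Longrightarrow> bounded_below_on UNIV (shift T s)"
proof (cases "t \<in> approximate_spectrum T")
  case False
  then obtain c where c: "c > 0" "\<And>f. c * norm f \<le> norm (shift T t f)"
    by (auto simp: approximate_spectrum_def bounded_below_on_def)
  have "c / 2 * norm f \<le> norm (shift T s f)" if s: "\<bar>s - t\<bar> < c / 2" for s f
  proof -
    have "norm (shift T t f) \<le> norm (shift T s f) + norm ((s - t) *\<^sub>R f)"
      using norm_triangle_ineq[of "shift T s f" "(s - t) *\<^sub>R f"] by (simp add: algebra_simps)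
    moreover have "norm ((s - t) *\<^sub>R f) \<le> c / 2 * norm f"
      unfolding norm_scaleR using s by (intro mult_right_mono) auto
    ultimately show ?thesis using c(2)[of f] by simp
  qed
  then have bb: "bounded_below_on UNIV (shift T s)" if "\<bar>s - t\<bar> < c / 2" for s
    using that c(1) unfolding bounded_below_on_def by (intro exI[of _ "c / 2"]) auto
  have "c / 2 * norm f \<le> norm (shift T t f)" for f
    using c(1) c(2)[of f] by (smt (verit) field_sum_of_halves mult_right_mono norm_ge_zero)
  then show ?thesis using that[of "c / 2" "{}"] bb c(1) by auto
next
  case True
  then obtain C where iso: "t isolated_in approximate_spectrum T"
    and C: "finite C" "C \<subseteq> eigenspace T t" "eigenspace T t \<subseteq> span C"
    using t by (auto simp: essential_spectrum_def)
  obtain \<delta> where \<delta>: "\<delta> > 0" "\<And>s. s \<in> approximate_spectrum T \<Longrightarrow> dist t s < \<delta> \<Longrightarrow> s = t"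
    using iso by (auto simp: isolated_in_dist_Ex_iff)
  have bb: "bounded_below_on UNIV (shift T s)" if "s \<noteq> t" "\<bar>s - t\<bar> < \<delta>" for s
    using \<delta>(2)[of s] that by (auto simp: approximate_spectrum_def dist_real_def abs_minus_commute)
  have "\<delta> * norm f \<le> norm (shift T t f)" if f: "f \<in> C\<^sup>\<bottom>" for f
  proof (rule bounded_below_off_kernel[OF selfadjoint_shift[OF T] \<delta>(1)])
    show "bounded_below_on UNIV (shift (shift T t) x)" if "0 < \<bar>x\<bar>" "\<bar>x\<bar> < \<delta>" for x
      using bb[of "t + x"] that by (simp add: scaleR_add_left diff_diff_eq)
    have "C \<subseteq> {g. g \<bullet> f = 0}" using f by (auto simp: mem_orthogonal_comp)
    then have "span C \<subseteq> {g. g \<bullet> f = 0}"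
      by (rule span_minimal) (auto simp: subspace_def inner_add_left)
    then show "f \<in> {g. shift T t g = 0}\<^sup>\<bottom>"
      using C(3) by (auto simp: mem_orthogonal_comp eigenspace_def)
  qed
  then show ?thesis using that[of \<delta> C] \<delta>(1) C bb by blast
qed

text \<open>
  By compactness, finitely many of the neighbourhoods from \<open>outside_essential_spectrum\<close> cover \<open>[a, b]\<close>.
  The complement of the finitely many eigenvectors \<open>B\<close> collected in this way is invariant, and on it \<open>T - s\<close>
  is bounded below for all \<open>s\<close> in \<open>[a, b)\<close>, so the lower bound of the form improves from \<open>a\<close> to \<open>b\<close>.
\<close>

lemma form_bound_of_essential_spectrum:
  fixes T :: "'a::{real_inner,complete_space} \<Rightarrow> 'a"
  assumes T: "selfadjoint T"
    and a: "\<And>f. a * (f \<bullet> f) \<le> T f \<bullet> f"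
    and ess: "essential_spectrum T \<inter> {a..b} = {}"
  shows "\<exists>B. finite B \<and> (\<forall>f\<in>B\<^sup>\<bottom>. b * (f \<bullet> f) \<le> T f \<bullet> f)"
proof -
  interpret bounded_linear T using T by (rule selfadjointD)
  define good where "good t \<delta> C \<longleftrightarrow> \<delta> > 0 \<and> finite C \<and> C \<subseteq> eigenspace T t \<and>
      (\<forall>f\<in>C\<^sup>\<bottom>. \<delta> * norm f \<le> norm (shift T t f)) \<and>
      (\<forall>s. s \<noteq> t \<longrightarrow> \<bar>s - t\<bar> < \<delta> \<longrightarrow> bounded_below_on UNIV (shift T s))" for t \<delta> C
  have "\<forall>t\<in>{a..b}. \<exists>p. good t (fst p) (snd p)"
  proof
    fix t assume "t \<in> {a..b}"
    then have "t \<notin> essential_spectrum T" using ess by blast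
    from outside_essential_spectrum[OF T this] obtain \<delta> C where "good t \<delta> C"
      unfolding good_def by metis
    then show "\<exists>p. good t (fst p) (snd p)" by (intro exI[of _ "(\<delta>, C)"]) simp
  qed
  then obtain p where p: "\<forall>t\<in>{a..b}. good t (fst (p t)) (snd (p t))"
    by (rule bchoice[THEN exE])
  define \<delta> where "\<delta> t = fst (p t)" for t
  define C where "C t = snd (p t)" for t
  have \<delta>C: "good t (\<delta> t) (C t)" if "t \<in> {a..b}" for t
    using p that by (simp add: \<delta>_def C_def)
  have pos: "\<delta> t > 0" and fin: "finite (C t)" and eig: "C t \<subseteq> eigenspace T t" if "t \<in> {a..b}" for t
    using \<delta>C[OF that] by (simp_all add: good_def)
  have "{a..b} \<subseteq> (\<Union>t\<in>{a..b}. ball t (\<delta> t))"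
    using pos by force
  then obtain I where I: "I \<subseteq> {a..b}" "finite I" "{a..b} \<subseteq> (\<Union>t\<in>I. ball t (\<delta> t))"
    using compactE_image[OF compact_Icc, of "{a..b}" "\<lambda>t. ball t (\<delta> t)" a b] by (metis open_ball)
  define B where "B = (\<Union>t\<in>I. C t)"
  have B: "finite B" unfolding B_def using I(2) fin subsetD[OF I(1)] by (intro finite_UN_I) auto
  have inv: "T f \<in> B\<^sup>\<bottom>" if f: "f \<in> B\<^sup>\<bottom>" for f
    unfolding mem_orthogonal_comp
  proof
    fix b assume b: "b \<in> B"
    then obtain t where "t \<in> I" "b \<in> C t" by (auto simp: B_def)
    then have "b \<in> eigenspace T t" using eig[of t] I(1) by blast
    then have "T b = t *\<^sub>R b" by (simp add: eigenspace_def)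
    then have "b \<bullet> T f = t * (b \<bullet> f)" by (simp flip: selfadjointD(2)[OF T])
    then show "b \<bullet> T f = 0" using f b by (simp add: mem_orthogonal_comp)
  qed
  have "b * (f \<bullet> f) \<le> T f \<bullet> f" if "f \<in> B\<^sup>\<bottom>" for f
  proof (rule form_lower_bound_improve[OF T subspace_orthogonal_comp inv a _ that])
    fix s assume s: "a \<le> s" "s < b"
    then obtain t where t: "t \<in> I" "\<bar>s - t\<bar> < \<delta> t"
      using I(3) by (force simp: dist_real_def)
    then have "t \<in> {a..b}" using I(1) by blast
    note P = \<delta>C[OF this, unfolded good_def]
    show "bounded_below_on (B\<^sup>\<bottom>) (shift T s)"
    proof (cases "s = t")
      case True
      have "B\<^sup>\<bottom> \<subseteq> (C t)\<^sup>\<bottom>" using t(1) by (intro orthogonal_comp_anti_mono) (auto simp: B_def)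
      then show ?thesis
        unfolding bounded_below_on_def using P True by (intro exI[of _ "\<delta> t"]) auto
    next
      case False
      then have "bounded_below_on UNIV (shift T s)" using P t(2) by blast
      then show ?thesis unfolding bounded_below_on_def by blast
    qed
  qed
  then show ?thesis using B by blast
qed

text \<open>
  The hypothesis on the form expresses compactness of \<open>T - c\<close>. For \<open>t \<noteq> c\<close> it makes \<open>T - t\<close> bounded
  below on a subspace of finite codimension. Therefore the eigenspace of \<open>t\<close> has finite dimension, a
  spectral point \<open>t\<close> is an eigenvalue (\<open>bounded_below_finite_codim\<close>), and \<open>T - t\<close> is bounded below on the
  complement of the eigenspace; eigenvectors for other eigenvalues lie in this complement, which keeps
  those eigenvalues away from \<open>t\<close>. The point \<open>c\<close> itself is essential because \<open>T - c\<close> has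
  arbitrarily small norm on subspaces of finite codimension, all of which are nonzero.
\<close>

lemma essential_spectrum_single:
  fixes T :: "'a::{real_inner,complete_space} \<Rightarrow> 'a"
  assumes T: "selfadjoint T"
    and form: "\<And>\<epsilon>. \<epsilon> > 0 \<Longrightarrow>
      \<exists>B. finite B \<and> (\<forall>f\<in>B\<^sup>\<bottom>. \<bar>shift T c f \<bullet> f\<bar> \<le> \<epsilon> * (f \<bullet> f))"
    and inf: "\<And>B :: 'a set. finite B \<Longrightarrow> \<exists>f\<in>B\<^sup>\<bottom>. f \<noteq> 0"
  shows "essential_spectrum T = {c}"
proof -
  interpret bounded_linear T using T by (rule selfadjointD)
  have codim: "\<exists>B. finite B \<and> (\<forall>f\<in>B\<^sup>\<bottom>. \<bar>t - c\<bar> / 2 * norm f \<le> norm (shift T t f))"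
    if t: "t \<noteq> c" for t
  proof -
    obtain B where B: "finite B"
      "\<And>f. f \<in> B\<^sup>\<bottom> \<Longrightarrow> \<bar>shift T c f \<bullet> f\<bar> \<le> \<bar>t - c\<bar> / 2 * (f \<bullet> f)"
      using form[of "\<bar>t - c\<bar> / 2"] t by fastforce
    have "\<bar>t - c\<bar> / 2 * norm f \<le> norm (shift T t f)" if f: "f \<in> B\<^sup>\<bottom>" for f
    proof (cases "f = 0")
      case False
      have "\<bar>t - c\<bar> * (f \<bullet> f) = \<bar>shift T c f \<bullet> f - shift T t f \<bullet> f\<bar>"
        by (simp add: inner_diff abs_mult flip: left_diff_distrib)
      also have "\<dots> \<le> \<bar>t - c\<bar> / 2 * (f \<bullet> f) + norm (shift T t f) * norm f"
        using B(2)[OF f] Cauchy_Schwarz_ineq2[of "shift T t f" f] by linarith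
      finally have "(\<bar>t - c\<bar> / 2 * norm f) * norm f \<le> norm (shift T t f) * norm f"
        by (simp add: power2_eq_square flip: power2_norm_eq_inner)
      then show ?thesis using False by simp
    qed simp
    then show ?thesis using B(1) by blast
  qed
  have eig: "eigenspace T t \<noteq> {0}" if t: "t \<noteq> c" "t \<in> approximate_spectrum T" for t
  proof
    assume 0: "eigenspace T t = {0}"
    obtain B where B: "finite B" "\<forall>f\<in>B\<^sup>\<bottom>. \<bar>t - c\<bar> / 2 * norm f \<le> norm (shift T t f)"
      using codim[OF t(1)] by blast
    have "bounded_below_on UNIV (shift T t)"
    proof (rule bounded_below_finite_codim[OF _ subspace_UNIV closed_UNIV _ B(1)])
      show "bounded_linear (shift T t)" by (intro selfadjointD selfadjoint_shift T)
      show "bounded_below_on (UNIV \<inter> B\<^sup>\<bottom>) (shift T t)"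
        unfolding bounded_below_on_def using B(2) t(1) by (intro exI[of _ "\<bar>t - c\<bar> / 2"]) auto
      show "f = 0" if "shift T t f = 0" for f
        using that 0 by (auto simp: eigenspace_def)
    qed
    then show False using t(2) by (simp add: approximate_spectrum_def)
  qed
  have sub: "t \<notin> essential_spectrum T" if t: "t \<noteq> c" for t
  proof
    assume ess: "t \<in> essential_spectrum T"
    define N where "N = eigenspace T t"
    have N: "subspace N" unfolding N_def by (rule subspace_eigenspace[OF linear])
    obtain B where B: "finite B" "\<And>f. f \<in> B\<^sup>\<bottom> \<Longrightarrow> \<bar>t - c\<bar> / 2 * norm f \<le> norm (shift T t f)"
      using codim[OF t] by blast
    have "N \<inter> B\<^sup>\<bottom> \<subseteq> {0}"
    proof
      fix f assume f: "f \<in> N \<inter> B\<^sup>\<bottom>"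
      then have "\<bar>t - c\<bar> / 2 * norm f \<le> 0" using B(2)[of f] by (simp add: N_def eigenspace_def)
      then show "f \<in> {0}" using t by (simp add: mult_le_0_iff)
    qed
    then have fin: "\<exists>C. finite C \<and> C \<subseteq> N \<and> N \<subseteq> span C" by (rule finite_spanning_set[OF N B(1)])
    have "bounded_below_on (N\<^sup>\<bottom>) (shift T t)"
    proof (rule bounded_below_finite_codim[OF _ subspace_orthogonal_comp closed_orthogonal_comp _ B(1)])
      show "bounded_linear (shift T t)" by (intro selfadjointD selfadjoint_shift T)
      show "bounded_below_on (N\<^sup>\<bottom> \<inter> B\<^sup>\<bottom>) (shift T t)"
        unfolding bounded_below_on_def using B(2) t by (intro exI[of _ "\<bar>t - c\<bar> / 2"]) auto
      show "f = 0" if "f \<in> N\<^sup>\<bottom>" "shift T t f = 0" for f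
      proof -
        have "f \<in> N" using that by (simp add: N_def eigenspace_def)
        then have "f \<bullet> f = 0" using that(1) by (simp add: mem_orthogonal_comp)
        then show ?thesis by simp
      qed
    qed
    then obtain d where d: "d > 0" "\<And>f. f \<in> N\<^sup>\<bottom> \<Longrightarrow> d * norm f \<le> norm (shift T t f)"
      by (auto simp: bounded_below_on_def)
    have "s = t" if s: "s \<in> approximate_spectrum T" "dist t s < min d \<bar>t - c\<bar>" for s
    proof (rule ccontr)
      assume "s \<noteq> t"
      have "s \<noteq> c" using s(2) by (auto simp: dist_real_def)
      then have "eigenspace T s \<noteq> {0}" using eig s(1) by blast
      then obtain f where f: "T f = s *\<^sub>R f" "f \<noteq> 0"
        using subspace_0[OF subspace_eigenspace[OF linear, of s]] by (auto simp: eigenspace_def)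
      have "f \<in> N\<^sup>\<bottom>"
        unfolding mem_orthogonal_comp
      proof
        fix g assume "g \<in> N"
        then have "t * (g \<bullet> f) = s * (g \<bullet> f)"
          using selfadjointD(2)[OF T, of g f] f(1) by (simp add: N_def eigenspace_def)
        then show "g \<bullet> f = 0" using \<open>s \<noteq> t\<close> by simp
      qed
      then have "d * norm f \<le> norm ((s - t) *\<^sub>R f)"
        using d(2)[of f] f(1) by (simp add: scaleR_diff_left)
      then have "d \<le> \<bar>s - t\<bar>" using f(2) by simp
      then show False using s(2) by (simp add: dist_real_def abs_minus_commute)
    qed
    moreover have "t \<in> approximate_spectrum T" using ess by (simp add: essential_spectrum_def)
    moreover have "min d \<bar>t - c\<bar> > 0" using d t by simp
    ultimately have "t isolated_in approximate_spectrum T"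
      unfolding isolated_in_dist_Ex_iff by blast
    moreover have "N \<noteq> {0}" unfolding N_def
      using eig[OF t] ess by (simp add: essential_spectrum_def)
    ultimately show False using ess fin by (auto simp: essential_spectrum_def N_def)
  qed
  have "c \<in> essential_spectrum T"
  proof (rule ccontr)
    assume "c \<notin> essential_spectrum T"
    then obtain \<delta> C where \<delta>: "\<delta> > 0" and C: "finite C"
      "\<And>f. f \<in> C\<^sup>\<bottom> \<Longrightarrow> \<delta> * norm f \<le> norm (shift T c f)"
      using outside_essential_spectrum[OF T] by metis
    define A where "A = shift T c"
    have A: "selfadjoint A" unfolding A_def by (rule selfadjoint_shift[OF T])
    interpret A: bounded_linear A using A by (rule selfadjointD)
    obtain B where B: "finite B" "\<And>f. f \<in> B\<^sup>\<bottom> \<Longrightarrow> \<bar>A f \<bullet> f\<bar> \<le> \<delta> / 2 * (f \<bullet> f)"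
      using form[of "\<delta> / 2"] \<delta> by (auto simp: A_def)
    \<comment> \<open>Orthogonality to the image of B under A places A f in the subspace where the form is small.\<close>
    obtain f where f: "f \<in> (C \<union> B \<union> A ` B)\<^sup>\<bottom>" "f \<noteq> 0"
      using inf[of "C \<union> B \<union> A ` B"] B(1) C(1) by auto
    define h where "h = A f"
    have fB: "f \<in> B\<^sup>\<bottom>" and fC: "f \<in> C\<^sup>\<bottom>" and hB: "h \<in> B\<^sup>\<bottom>"
      using f(1) by (auto simp: mem_orthogonal_comp h_def simp flip: selfadjointD(2)[OF A])
    have big: "\<delta> * norm f \<le> norm h" using C(2)[OF fC] by (simp add: h_def A_def)
    then have h0: "norm h > 0" using \<delta> f(2) by (metis mult_pos_pos not_less order_trans zero_less_norm_iff)
    \<comment> \<open>Polarisation at f and h = A f turns smallness of the form into smallness of A f; the factor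
      gives both vectors the same length.\<close>
    define \<tau> where "\<tau> = norm f / norm h"
    have sub: "f + \<tau> *\<^sub>R h \<in> B\<^sup>\<bottom>" "f - \<tau> *\<^sub>R h \<in> B\<^sup>\<bottom>"
      using fB hB by (simp_all add: subspace_orthogonal_comp subspace_add subspace_diff subspace_scale)
    have "4 * \<tau> * (h \<bullet> h) = A (f + \<tau> *\<^sub>R h) \<bullet> (f + \<tau> *\<^sub>R h) - A (f - \<tau> *\<^sub>R h) \<bullet> (f - \<tau> *\<^sub>R h)"
      using selfadjointD(2)[OF A, of h f]
      by (simp add: A.add A.diff A.scaleR inner_add inner_diff inner_commute h_def algebra_simps)
    also have "\<dots> \<le> \<delta> / 2 * ((f + \<tau> *\<^sub>R h) \<bullet> (f + \<tau> *\<^sub>R h)) + \<delta> / 2 * ((f - \<tau> *\<^sub>R h) \<bullet> (f - \<tau> *\<^sub>R h))"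
      using B(2)[OF sub(1)] B(2)[OF sub(2)] by linarith
    also have "\<dots> = \<delta> * (f \<bullet> f + \<tau>\<^sup>2 * (h \<bullet> h))"
      by (simp add: inner_add inner_diff inner_commute power2_eq_square algebra_simps)
    also have "\<tau>\<^sup>2 * (h \<bullet> h) = f \<bullet> f"
      using h0 by (simp add: \<tau>_def power_divide flip: power2_norm_eq_inner)
    also have "4 * \<tau> * (h \<bullet> h) = 4 * norm f * norm h"
      using h0 by (simp add: \<tau>_def power2_eq_square flip: power2_norm_eq_inner)
    finally have "4 * norm h * norm f \<le> 2 * \<delta> * norm f * norm f"
      by (simp add: power2_eq_square mult_ac flip: power2_norm_eq_inner)
    then have "4 * norm h \<le> 2 * \<delta> * norm f" using f(2) by simp
    then show False using big h0 by linarith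
  qed
  with sub show ?thesis by blast
qed

section \<open>The Hilbert space of square-summable functions\<close>

lemma square_summable_product:
  fixes f g :: "'v \<Rightarrow> real"
  assumes "(\<lambda>x. (f x)\<^sup>2) summable_on UNIV" "(\<lambda>x. (g x)\<^sup>2) summable_on UNIV"
  shows "(\<lambda>x. f x * g x) summable_on UNIV"
proof -
  have "(\<lambda>x. (f x)\<^sup>2 + (g x)\<^sup>2) summable_on UNIV"
    using assms by (rule summable_on_add)
  then have "(\<lambda>x. norm (f x * g x)) summable_on UNIV"
  proof (rule summable_on_comparison_test)
    fix x
    have "2 * (\<bar>f x\<bar> * \<bar>g x\<bar>) \<le> (f x)\<^sup>2 + (g x)\<^sup>2"
      using sum_squares_bound[of "\<bar>f x\<bar>" "\<bar>g x\<bar>"] by simp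
    moreover have "0 \<le> \<bar>f x\<bar> * \<bar>g x\<bar>" by simp
    ultimately show "norm (f x * g x) \<le> (f x)\<^sup>2 + (g x)\<^sup>2"
      unfolding real_norm_def abs_mult by linarith
  qed auto
  then show ?thesis by (rule abs_summable_summable)
qed

lemma square_summable_add:
  fixes f g :: "'v \<Rightarrow> real"
  assumes "(\<lambda>x. (f x)\<^sup>2) summable_on UNIV" "(\<lambda>x. (g x)\<^sup>2) summable_on UNIV"
  shows "(\<lambda>x. (f x + g x)\<^sup>2) summable_on UNIV"
proof -
  have "(\<lambda>x. ((f x)\<^sup>2 + (g x)\<^sup>2) + 2 * (f x * g x)) summable_on UNIV"
    by (intro summable_on_add summable_on_cmult_right square_summable_product assms)
  then show ?thesis by (simp add: power2_sum algebra_simps)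
qed

lemma square_summable_scale:
  fixes f :: "'v \<Rightarrow> real"
  assumes "(\<lambda>x. (f x)\<^sup>2) summable_on UNIV"
  shows "(\<lambda>x. (c * f x)\<^sup>2) summable_on UNIV"
  using summable_on_cmult_right[OF assms, of "c\<^sup>2"] by (simp add: power_mult_distrib)

text \<open>
  A type cannot depend on the weights. The space is therefore the unweighted one, and functions \<open>f\<close> in
  the weighted space are represented by \<open>sqrt (\<mu>(x)) f(x)\<close>; see \<open>to_ell2\<close> below.
\<close>

typedef 'v ell2 = "{f :: 'v \<Rightarrow> real. (\<lambda>x. (f x)\<^sup>2) summable_on UNIV}"
  morphisms coord Abs_ell2
  by (rule exI[of _ "\<lambda>_. 0"]) simp

setup_lifting type_definition_ell2

instantiation ell2 :: (type) real_vector
begin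

lift_definition zero_ell2 :: "'a ell2" is "\<lambda>_. 0" by simp
lift_definition plus_ell2 :: "'a ell2 \<Rightarrow> 'a ell2 \<Rightarrow> 'a ell2" is "\<lambda>f g x. f x + g x"
  by (rule square_summable_add)
lift_definition scaleR_ell2 :: "real \<Rightarrow> 'a ell2 \<Rightarrow> 'a ell2" is "\<lambda>c f x. c * f x"
  by (rule square_summable_scale)
lift_definition uminus_ell2 :: "'a ell2 \<Rightarrow> 'a ell2" is "\<lambda>f x. - f x" by simp
lift_definition minus_ell2 :: "'a ell2 \<Rightarrow> 'a ell2 \<Rightarrow> 'a ell2" is "\<lambda>f g x. f x - g x"
proof -
  fix f g :: "'a \<Rightarrow> real"
  assume "(\<lambda>x. (f x)\<^sup>2) summable_on UNIV" "(\<lambda>x. (g x)\<^sup>2) summable_on UNIV"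
  then show "(\<lambda>x. (f x - g x)\<^sup>2) summable_on UNIV"
    using square_summable_add[of f "\<lambda>x. - g x"] by simp
qed

instance
  by intro_classes (transfer; simp add: algebra_simps)+

end

instantiation ell2 :: (type) real_inner
begin

lift_definition inner_ell2 :: "'a ell2 \<Rightarrow> 'a ell2 \<Rightarrow> real" is "\<lambda>f g. \<Sum>\<^sub>\<infinity>x. f x * g x" .
definition norm_ell2 :: "'a ell2 \<Rightarrow> real" where "norm_ell2 F = sqrt (inner F F)"
definition sgn_ell2 :: "'a ell2 \<Rightarrow> 'a ell2" where "sgn_ell2 F = F /\<^sub>R norm F"
definition dist_ell2 :: "'a ell2 \<Rightarrow> 'a ell2 \<Rightarrow> real" where "dist_ell2 F G = norm (F - G)"
definition uniformity_ell2 :: "('a ell2 \<times> 'a ell2) filter" where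
  "uniformity_ell2 = (INF e\<in>{0<..}. principal {(x, y). dist x y < e})"
definition open_ell2 :: "'a ell2 set \<Rightarrow> bool" where
  "open_ell2 U = (\<forall>x\<in>U. eventually (\<lambda>(x', y). x' = x \<longrightarrow> y \<in> U) uniformity)"

instance
proof
  fix F G H :: "'a ell2" and r :: real
  show "inner F G = inner G F" by transfer (simp add: mult.commute)
  show "inner (F + G) H = inner F H + inner G H"
    by transfer (simp add: distrib_right infsum_add square_summable_product)
  show "inner (r *\<^sub>R F) G = r * inner F G"
    by transfer (simp add: mult.assoc infsum_cmult_right')
  show "0 \<le> inner F F" by transfer (simp add: infsum_nonneg)
  show "inner F F = 0 \<longleftrightarrow> F = 0"
  proof transfer
    fix f :: "'a \<Rightarrow> real"
    assume f: "(\<lambda>x. (f x)\<^sup>2) summable_on UNIV"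
    show "((\<Sum>\<^sub>\<infinity>x. f x * f x) = 0) = (f = (\<lambda>_. 0))"
    proof
      assume 0: "(\<Sum>\<^sub>\<infinity>x. f x * f x) = 0"
      show "f = (\<lambda>_. 0)"
      proof
        show "f x = 0" for x
          using nonneg_infsum_le_0D[of "\<lambda>x. (f x)\<^sup>2" UNIV x] f 0 by (simp add: power2_eq_square)
      qed
    qed simp
  qed
qed (simp_all add: norm_ell2_def sgn_ell2_def dist_ell2_def uniformity_ell2_def open_ell2_def)

end

lemma coord_simps [simp]:
  "coord 0 x = 0" "coord (F + G) x = coord F x + coord G x"
  "coord (F - G) x = coord F x - coord G x" "coord (c *\<^sub>R F) x = c * coord F x"
  by (transfer; simp)+

lemma coord_sum [simp]: "coord (\<Sum>i\<in>I. F i) x = (\<Sum>i\<in>I. coord (F i) x)"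
  by (induction I rule: infinite_finite_induct) auto

lemma ell2_eqI: "(\<And>x. coord F x = coord G x) \<Longrightarrow> F = G"
  by (simp add: coord_inject[symmetric] fun_eq_iff)

lemma coord_square_summable: "(\<lambda>x. (coord F x)\<^sup>2) summable_on UNIV"
  using coord[of F] by simp

lemma coord_Abs: "(\<lambda>x. (f x)\<^sup>2) summable_on UNIV \<Longrightarrow> coord (Abs_ell2 f) = f"
  by (simp add: Abs_ell2_inverse)

lemma norm_ell2_square: "(norm F)\<^sup>2 = (\<Sum>\<^sub>\<infinity>x. (coord F x)\<^sup>2)"
  unfolding power2_norm_eq_inner by transfer (simp add: power2_eq_square)

lemma sum_coord_le_norm: "finite A \<Longrightarrow> (\<Sum>x\<in>A. (coord F x)\<^sup>2) \<le> (norm F)\<^sup>2"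
  unfolding norm_ell2_square by (intro finite_sum_le_infsum coord_square_summable) auto

lemma coord_le_norm: "\<bar>coord F x\<bar> \<le> norm F"
  using sum_coord_le_norm[of "{x}" F] abs_le_square_iff[of "coord F x" "norm F"] by simp

text \<open>
  A sum of nonnegative terms is the supremum of its finite partial sums. Both the limit of a Cauchy
  sequence and the image under the transition operator are constructed from bounds on these.
\<close>

lemma Abs_ell2_bounded:
  assumes "\<And>A. finite A \<Longrightarrow> (\<Sum>x\<in>A. (f x)\<^sup>2) \<le> C\<^sup>2" "0 \<le> C"
  shows "(\<lambda>x. (f x)\<^sup>2) summable_on UNIV" "norm (Abs_ell2 f) \<le> C"
proof -
  show s: "(\<lambda>x. (f x)\<^sup>2) summable_on UNIV"
    by (rule nonneg_bdd_above_summable_on) (use assms in \<open>auto intro!: bdd_aboveI\<close>)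
  have "(norm (Abs_ell2 f))\<^sup>2 \<le> C\<^sup>2"
    unfolding norm_ell2_square coord_Abs[OF s] by (rule infsum_le_finite_sums[OF s]) (use assms in auto)
  then show "norm (Abs_ell2 f) \<le> C" using assms(2) by (rule power2_le_imp_le)
qed

instance ell2 :: (type) complete_space
proof
  fix X :: "nat \<Rightarrow> 'a ell2"
  assume X: "Cauchy X"
  have "Cauchy (\<lambda>n. coord (X n) x)" for x
  proof (rule metric_CauchyI)
    fix e :: real assume "e > 0"
    then obtain N where N: "\<And>m n. m \<ge> N \<Longrightarrow> n \<ge> N \<Longrightarrow> dist (X m) (X n) < e"
      using metric_CauchyD[OF X] by metis
    have "dist (coord (X m) x) (coord (X n) x) < e" if "m \<ge> N" "n \<ge> N" for m n
      using N[OF that] coord_le_norm[of "X m - X n" x] by (simp add: dist_norm)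
    then show "\<exists>N. \<forall>m\<ge>N. \<forall>n\<ge>N. dist (coord (X m) x) (coord (X n) x) < e" by blast
  qed
  then have "\<forall>x. \<exists>l. (\<lambda>n. coord (X n) x) \<longlonglongrightarrow> l"
    by (simp add: convergent_eq_Cauchy)
  then obtain g where g: "\<And>x. (\<lambda>n. coord (X n) x) \<longlonglongrightarrow> g x" by metis
  have tail: "\<exists>N. \<forall>n\<ge>N. \<forall>A. finite A \<longrightarrow> (\<Sum>x\<in>A. (g x - coord (X n) x)\<^sup>2) \<le> e\<^sup>2"
    if e: "e > 0" for e
  proof -
    obtain N where N: "\<And>m n. m \<ge> N \<Longrightarrow> n \<ge> N \<Longrightarrow> dist (X m) (X n) < e"
      using metric_CauchyD[OF X e] by metis
    have "(\<Sum>x\<in>A. (g x - coord (X n) x)\<^sup>2) \<le> e\<^sup>2" if n: "n \<ge> N" and A: "finite A" for n A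
    proof (rule tendsto_upperbound)
      show "(\<lambda>m. \<Sum>x\<in>A. (coord (X m) x - coord (X n) x)\<^sup>2) \<longlonglongrightarrow> (\<Sum>x\<in>A. (g x - coord (X n) x)\<^sup>2)"
        by (intro tendsto_intros g)
      show "\<forall>\<^sub>F m in sequentially. (\<Sum>x\<in>A. (coord (X m) x - coord (X n) x)\<^sup>2) \<le> e\<^sup>2"
        unfolding eventually_sequentially
      proof (intro exI allI impI)
        fix m assume m: "N \<le> m"
        have "(\<Sum>x\<in>A. (coord (X m - X n) x)\<^sup>2) \<le> (norm (X m - X n))\<^sup>2"
          using A by (rule sum_coord_le_norm)
        also have "\<dots> \<le> e\<^sup>2"
          using N[OF m n] by (intro power_mono) (auto simp: dist_norm)
        finally show "(\<Sum>x\<in>A. (coord (X m) x - coord (X n) x)\<^sup>2) \<le> e\<^sup>2" by simp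
      qed
    qed simp
    then show ?thesis by blast
  qed
  obtain N where "\<And>A. finite A \<Longrightarrow> (\<Sum>x\<in>A. (g x - coord (X N) x)\<^sup>2) \<le> 1\<^sup>2"
    using tail[of 1] by auto
  from Abs_ell2_bounded(1)[OF this] have "(\<lambda>x. (g x - coord (X N) x)\<^sup>2) summable_on UNIV" by simp
  from square_summable_add[OF this coord_square_summable[of "X N"]]
  have gs: "(\<lambda>x. (g x)\<^sup>2) summable_on UNIV" by simp
  have "X \<longlonglongrightarrow> Abs_ell2 g"
  proof (rule metric_LIMSEQ_I)
    fix e :: real assume "e > 0"
    then obtain N where N: "\<And>n A. n \<ge> N \<Longrightarrow> finite A \<Longrightarrow> (\<Sum>x\<in>A. (g x - coord (X n) x)\<^sup>2) \<le> (e / 2)\<^sup>2"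
      using tail[of "e / 2"] by auto
    have "dist (X n) (Abs_ell2 g) < e" if "n \<ge> N" for n
    proof -
      have "Abs_ell2 (\<lambda>x. g x - coord (X n) x) = Abs_ell2 g - X n"
        by (rule ell2_eqI) (use \<open>e > 0\<close> in \<open>simp add: coord_Abs[OF gs]
          coord_Abs[OF Abs_ell2_bounded(1)[OF N[OF that]]]\<close>)
      then have "norm (Abs_ell2 g - X n) \<le> e / 2"
        using Abs_ell2_bounded(2)[OF N[OF that]] \<open>e > 0\<close> by simp
      then show ?thesis using \<open>e > 0\<close> by (simp add: dist_norm norm_minus_commute)
    qed
    then show "\<exists>N. \<forall>n\<ge>N. dist (X n) (Abs_ell2 g) < e" by blast
  qed
  then show "convergent X" by (auto simp: convergent_def)
qed

lift_definition unit :: "'v \<Rightarrow> 'v ell2" is "\<lambda>x y. if y = x then 1 else 0"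
  by (rule finite_nonzero_values_imp_summable_on) simp

lemma coord_unit: "coord (unit x) y = (if y = x then 1 else 0)"
  by transfer simp

lemma inner_unit: "F \<bullet> unit x = coord F x"
proof transfer
  fix f :: "'a \<Rightarrow> real" and x
  have "(\<Sum>\<^sub>\<infinity>y. f y * (if y = x then 1 else 0)) = (\<Sum>\<^sub>\<infinity>y\<in>{x}. f y)"
    by (rule infsum_cong_neutral) auto
  then show "(\<Sum>\<^sub>\<infinity>y. f y * (if y = x then 1 else 0)) = f x" by simp
qed

lemma ell2_has_sum_units: "((\<lambda>x. coord F x *\<^sub>R unit x) has_sum F) UNIV"
proof -
  define S where "S A = (\<Sum>x\<in>A. coord F x *\<^sub>R unit x)" for A
  have dist: "(norm (S A - F))\<^sup>2 = (norm F)\<^sup>2 - (\<Sum>x\<in>A. (coord F x)\<^sup>2)" if A: "finite A" for A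
  proof -
    have FS: "F \<bullet> S A = (\<Sum>x\<in>A. (coord F x)\<^sup>2)"
      by (simp add: S_def inner_sum_right inner_unit power2_eq_square)
    have "coord (S A) x = coord F x" if "x \<in> A" for x
      using A that by (simp add: S_def coord_unit if_distrib[of "(*) _"] cong: if_cong)
    then have "S A \<bullet> S A = (\<Sum>x\<in>A. (coord F x)\<^sup>2)"
      by (subst (2) S_def) (simp add: inner_sum_right inner_unit power2_eq_square)
    then show ?thesis
      using FS by (simp add: power2_norm_eq_inner inner_diff inner_commute)
  qed
  have "((\<lambda>A. (norm F)\<^sup>2 - (\<Sum>x\<in>A. (coord F x)\<^sup>2)) \<longlongrightarrow> (norm F)\<^sup>2 - (norm F)\<^sup>2) (finite_subsets_at_top UNIV)"
    unfolding norm_ell2_square by (intro tendsto_intros infsum_tendsto coord_square_summable)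
  then have "((\<lambda>A. (norm (S A - F))\<^sup>2) \<longlongrightarrow> 0) (finite_subsets_at_top UNIV)"
    using dist by (subst tendsto_cong[where g = "\<lambda>A. (norm F)\<^sup>2 - (\<Sum>x\<in>A. (coord F x)\<^sup>2)"])
      (auto intro!: eventually_finite_subsets_at_top_weakI)
  then have "((\<lambda>A. sqrt ((norm (S A - F))\<^sup>2)) \<longlongrightarrow> sqrt 0) (finite_subsets_at_top UNIV)"
    by (rule tendsto_real_sqrt)
  then have "((\<lambda>A. norm (S A - F)) \<longlongrightarrow> 0) (finite_subsets_at_top UNIV)" by simp
  then show ?thesis
    unfolding has_sum_def S_def by (simp add: LIM_zero_iff tendsto_norm_zero_iff)
qed

text \<open>
  The coordinate expansion converges (\<open>ell2_has_sum_units\<close>), so identities between continuous functionals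
  can be checked on unit vectors.
\<close>

lemma bounded_linear_eq_on_units:
  assumes "bounded_linear f" "bounded_linear g" "\<And>x. f (unit x) = g (unit x)"
  shows "f F = (g F :: 'b::real_normed_vector)"
proof -
  interpret f: bounded_linear f by (rule assms)
  interpret g: bounded_linear g by (rule assms)
  have "((\<lambda>x. f (coord F x *\<^sub>R unit x)) has_sum f F) UNIV"
    by (rule has_sum_bounded_linear[OF assms(1) ell2_has_sum_units])
  moreover have "((\<lambda>x. g (coord F x *\<^sub>R unit x)) has_sum g F) UNIV"
    by (rule has_sum_bounded_linear[OF assms(2) ell2_has_sum_units])
  ultimately show ?thesis
    by (simp add: f.scaleR g.scaleR assms(3) has_sum_unique)
qed

section \<open>Inner edge weights and the Cheeger constants\<close>

context weighted_graph
begin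

lemma weight_zero: "(x, y) \<notin> E \<Longrightarrow> \<mu> x y = 0"
  using weight_nonneg[of x y] weight_pos_iff[of x y] by auto

definition neighbours :: "'v \<Rightarrow> 'v set" where "neighbours x = {y. (x, y) \<in> E}"

lemma finite_neighbours: "finite (neighbours x)"
  by (simp add: neighbours_def locally_finite)

lemma weight_outside_neighbours: "y \<notin> neighbours x \<Longrightarrow> \<mu> x y = 0"
  by (simp add: neighbours_def weight_zero)

lemma infsum_weight: "(\<Sum>\<^sub>\<infinity>y. \<mu> x y * f y) = (\<Sum>y\<in>neighbours x. \<mu> x y * f y)"
proof -
  have "(\<Sum>\<^sub>\<infinity>y. \<mu> x y * f y) = (\<Sum>\<^sub>\<infinity>y\<in>neighbours x. \<mu> x y * f y)"
    by (rule infsum_cong_neutral) (auto simp: weight_outside_neighbours)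
  then show ?thesis by (simp add: finite_neighbours)
qed

lemma vertex_weight_neighbours: "vertex_weight \<mu> x = (\<Sum>y\<in>neighbours x. \<mu> x y)"
  using infsum_weight[of x "\<lambda>_. 1"] by (simp add: vertex_weight_def)

lemma vertex_weight_pos: "0 < vertex_weight \<mu> x"
proof -
  have "UNIV \<noteq> {x}" using infinite_vertices by (metis finite.emptyI finite.insertI)
  then obtain y where "y \<noteq> x" by blast
  with connected[of x y] obtain z where "(x, z) \<in> E"
    by (metis converse_rtranclE)
  then have "0 < \<mu> x z" "z \<in> neighbours x" by (simp_all add: weight_pos_iff neighbours_def)
  then show ?thesis
    unfolding vertex_weight_neighbours by (intro sum_pos2[of _ z] finite_neighbours weight_nonneg)
qed

lemma vol_pos: "finite U \<Longrightarrow> U \<noteq> {} \<Longrightarrow> 0 < vol \<mu> U"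
  unfolding vol_def by (intro sum_pos vertex_weight_pos)

lemma vol_eq_boundary_plus_interior:
  assumes "finite U"
  shows "vol \<mu> U = boundary_weight \<mu> U + edge_weight_between \<mu> U U"
proof -
  have "vertex_weight \<mu> x = (\<Sum>\<^sub>\<infinity>y\<in>-U. \<mu> x y) + (\<Sum>y\<in>U. \<mu> x y)" for x
    using infsum_Un_disjoint[OF weight_summable weight_summable, of "-U" U x] assms
    by (simp add: vertex_weight_def Un_commute)
  then show ?thesis
    by (simp add: vol_def boundary_weight_def edge_weight_between_def sum.distrib)
qed

lemma boundary_ratio:
  assumes "finite U" "U \<noteq> {}"
  shows "boundary_weight \<mu> U / vol \<mu> U = 1 - edge_weight_between \<mu> U U / vol \<mu> U"
  using vol_pos[OF assms] vol_eq_boundary_plus_interior[OF assms(1)] by (simp add: field_simps)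

text \<open>
  This is the inequality \<open>1 - e \<le> h(V - K)\<close> in the form in which it is used, see
  \<open>interior_small_iff_cheeger\<close>. The empty set may be included among the sets \<open>U\<close>, since both sides are then \<open>0\<close>.
\<close>

definition interior_small :: "real \<Rightarrow> 'v set \<Rightarrow> bool" where
  "interior_small e K \<longleftrightarrow> (\<forall>U. finite U \<longrightarrow> U \<subseteq> - K \<longrightarrow> edge_weight_between \<mu> U U \<le> e * vol \<mu> U)"

lemma interior_small_iff_cheeger:
  assumes "finite K"
  shows "interior_small e K \<longleftrightarrow> 1 - e \<le> cheeger \<mu> (- K)"
proof -
  let ?S = "{boundary_weight \<mu> U / vol \<mu> U | U. U \<noteq> {} \<and> U \<subseteq> - K \<and> finite U}"
  have bdd: "bdd_below ?S"
    using cheeger_ratio_bounds(1) by (auto intro!: bdd_belowI)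
  obtain x where "x \<in> - K" using infinite_Compl[OF assms] by (metis finite.emptyI ex_in_conv)
  then have ne: "?S \<noteq> {}" by blast
  have ratio: "edge_weight_between \<mu> U U \<le> e * vol \<mu> U \<longleftrightarrow> 1 - e \<le> boundary_weight \<mu> U / vol \<mu> U"
    if "finite U" "U \<noteq> {}" for U
    using vol_pos[OF that] by (simp add: boundary_ratio[OF that] field_simps)
  show ?thesis
  proof
    assume small: "interior_small e K"
    show "1 - e \<le> cheeger \<mu> (- K)"
      unfolding cheeger_def
    proof (rule cInf_greatest[OF ne])
      fix r assume "r \<in> ?S"
      then obtain U where "r = boundary_weight \<mu> U / vol \<mu> U" "U \<noteq> {}" "U \<subseteq> - K" "finite U" by blast
      moreover from this have "edge_weight_between \<mu> U U \<le> e * vol \<mu> U"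
        using small by (simp add: interior_small_def)
      ultimately show "1 - e \<le> r" using ratio[of U] by simp
    qed
  next
    assume le: "1 - e \<le> cheeger \<mu> (- K)"
    show "interior_small e K"
      unfolding interior_small_def
    proof (intro allI impI)
      fix U assume U: "finite U" "U \<subseteq> - K"
      show "edge_weight_between \<mu> U U \<le> e * vol \<mu> U"
      proof (cases "U = {}")
        case True
        then show ?thesis by (simp add: edge_weight_between_def vol_def)
      next
        case False
        have "cheeger \<mu> (- K) \<le> boundary_weight \<mu> U / vol \<mu> U"
          unfolding cheeger_def using U False by (intro cInf_lower[OF _ bdd]) blast
        then show ?thesis using le ratio[OF U(1) False] by simp
      qed
    qed
  qed
qed

lemma cheeger_le_1:
  assumes "finite K"
  shows "cheeger \<mu> (- K) \<le> 1"
proof (rule ccontr)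
  assume gt: "\<not> ?thesis"
  then have "interior_small (1 - cheeger \<mu> (- K)) K"
    by (simp add: interior_small_iff_cheeger[OF assms])
  moreover obtain x where x: "x \<in> - K"
    using infinite_Compl[OF assms] by (metis finite.emptyI ex_in_conv)
  ultimately have "\<mu> x x \<le> (1 - cheeger \<mu> (- K)) * vertex_weight \<mu> x"
    unfolding interior_small_def by (auto simp: edge_weight_between_def vol_def dest: spec[of _ "{x}"])
  moreover have "(1 - cheeger \<mu> (- K)) * vertex_weight \<mu> x < 0"
    using gt vertex_weight_pos by (intro mult_neg_pos) auto
  ultimately show False using weight_nonneg[of x x] by linarith
qed

lemma cheeger_inf_eq_1_iff:
  "cheeger_inf \<mu> = 1 \<longleftrightarrow> (\<forall>e>0. \<exists>K. finite K \<and> interior_small e K)"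
proof -
  obtain K :: "nat \<Rightarrow> 'v set" where K: "exhaustion K" using exhaustion_exists by blast
  have fin: "finite (K n)" for n using K by (simp add: exhaustion_def)
  note lim = cheeger_inf_limit[OF K]
  show ?thesis
  proof (intro iffI allI impI)
    fix e :: real assume "cheeger_inf \<mu> = 1" "e > 0"
    then have "\<forall>\<^sub>F n in sequentially. 1 - e < cheeger \<mu> (- K n)"
      using order_tendstoD(1)[OF lim, of "1 - e"] by simp
    then obtain n where "1 - e < cheeger \<mu> (- K n)"
      by (auto simp: eventually_sequentially)
    then have "interior_small e (K n)" by (simp add: interior_small_iff_cheeger[OF fin])
    then show "\<exists>K. finite K \<and> interior_small e K" using fin by blast
  next
    assume small: "\<forall>e>0. \<exists>K. finite K \<and> interior_small e K"
    have "1 - e \<le> cheeger_inf \<mu>" if e: "e > 0" for e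
    proof -
      obtain K0 where K0: "finite K0" "interior_small e K0" using small e by blast
      have "\<forall>\<^sub>F n in sequentially. x \<in> K n" for x
      proof -
        have "x \<in> (\<Union>n. K n)" using K by (simp add: exhaustion_def)
        then obtain m where "x \<in> K m" by blast
        then show ?thesis
          using K unfolding exhaustion_def incseq_def eventually_sequentially by blast
      qed
      then have "\<forall>\<^sub>F n in sequentially. \<forall>x\<in>K0. x \<in> K n"
        using K0(1) by (intro eventually_ball_finite) auto
      then have "\<forall>\<^sub>F n in sequentially. 1 - e \<le> cheeger \<mu> (- K n)"
      proof (rule eventually_mono)
        fix n assume "\<forall>x\<in>K0. x \<in> K n"
        then have "interior_small e (K n)" using K0(2) by (auto simp: interior_small_def)
        then show "1 - e \<le> cheeger \<mu> (- K n)" by (simp add: interior_small_iff_cheeger[OF fin])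
      qed
      then show ?thesis by (intro tendsto_lowerbound[OF lim]) auto
    qed
    then have "1 \<le> cheeger_inf \<mu> + e" if "e > 0" for e
      using that by (simp add: diff_le_eq)
    then have "1 \<le> cheeger_inf \<mu>" by (rule field_le_epsilon)
    moreover have "cheeger_inf \<mu> \<le> 1"
      by (rule LIMSEQ_le_const2[OF lim]) (use cheeger_le_1[OF fin] in auto)
    ultimately show "cheeger_inf \<mu> = 1" by simp
  qed
qed

lemma edge_weight_Un:
  assumes "finite V1" "finite V2" "V1 \<inter> V2 = {}"
  shows "edge_weight_between \<mu> (V1 \<union> V2) (V1 \<union> V2) =
    edge_weight_between \<mu> V1 V1 + 2 * edge_weight_between \<mu> V1 V2 + edge_weight_between \<mu> V2 V2"
proof -
  have "edge_weight_between \<mu> V2 V1 = edge_weight_between \<mu> V1 V2"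
    unfolding edge_weight_between_def by (subst sum.swap) (simp add: weight_sym)
  then show ?thesis
    using assms by (simp add: edge_weight_between_def sum.union_disjoint sum.distrib)
qed

lemma vol_Un:
  "finite V1 \<Longrightarrow> finite V2 \<Longrightarrow> V1 \<inter> V2 = {} \<Longrightarrow> vol \<mu> (V1 \<union> V2) = vol \<mu> V1 + vol \<mu> V2"
  by (simp add: vol_def sum.union_disjoint)

lemma edge_weight_nonneg: "0 \<le> edge_weight_between \<mu> V1 V2"
  by (simp add: edge_weight_between_def sum_nonneg weight_nonneg)

text \<open>
  The greedy cut: each new vertex joins the side to which it has the smaller total weight, so at least
  half of the weight of its edges to earlier vertices crosses the cut. Every inner edge is counted twice
  in \<open>|E(U,U)|\<close> and every crossing edge once in \<open>|E(V1,V2)|\<close>, hence the factor \<open>4\<close>. A loop would never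
  cross the cut.
\<close>

lemma max_cut:
  assumes no_loops: "\<And>x. \<mu> x x = 0" and "finite U"
  shows "\<exists>V1 V2. V1 \<union> V2 = U \<and> V1 \<inter> V2 = {} \<and>
    edge_weight_between \<mu> U U \<le> 4 * edge_weight_between \<mu> V1 V2"
  using \<open>finite U\<close>
proof (induction U rule: finite_induct)
  case empty
  then show ?case by (simp add: edge_weight_between_def)
next
  case (insert x U)
  then obtain V1 V2 where V: "V1 \<union> V2 = U" "V1 \<inter> V2 = {}"
    "edge_weight_between \<mu> U U \<le> 4 * edge_weight_between \<mu> V1 V2" by blast
  have fin: "finite V1" "finite V2" using V(1) insert.hyps(1) by auto
  have x: "x \<notin> V1" "x \<notin> V2" using V(1) insert.hyps(2) by auto
  define d where "d W = (\<Sum>y\<in>W. \<mu> x y)" for W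
  have total: "edge_weight_between \<mu> (insert x U) (insert x U) = edge_weight_between \<mu> U U + 2 * d U"
    using insert.hyps
    by (simp add: edge_weight_between_def sum.distrib no_loops d_def weight_sym[of _ x])
  have dU: "d U = d V1 + d V2"
    unfolding d_def V(1)[symmetric] using fin V(2) by (rule sum.union_disjoint)
  have cut1: "edge_weight_between \<mu> (insert x V1) V2 = edge_weight_between \<mu> V1 V2 + d V2"
    using fin x by (simp add: edge_weight_between_def d_def)
  have cut2: "edge_weight_between \<mu> V1 (insert x V2) = edge_weight_between \<mu> V1 V2 + d V1"
    using fin x by (simp add: edge_weight_between_def d_def sum.distrib weight_sym[of _ x])
  show ?case
  proof (cases "d V1 \<le> d V2")
    case True
    then show ?thesis using V x total dU cut1
      by (intro exI[of _ "insert x V1"] exI[of _ V2]) auto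
  next
    case False
    then show ?thesis using V x total dU cut2
      by (intro exI[of _ V1] exI[of _ "insert x V2"]) auto
  qed
qed

text \<open>
  The first inequality holds since edges between \<open>V1\<close> and \<open>V2\<close> are inner edges of \<open>V1 \<union> V2\<close>, and the
  second one is \<open>max_cut\<close> applied to arbitrary finite sets outside \<open>K\<close>.
\<close>

lemma dual_cheeger_bounds:
  assumes K: "finite K"
  shows "dual_cheeger \<mu> (- K) \<le> 1 - cheeger \<mu> (- K)"
    and "(\<And>x. \<mu> x x = 0) \<Longrightarrow> 1 - cheeger \<mu> (- K) \<le> 2 * dual_cheeger \<mu> (- K)"
proof -
  let ?r = "\<lambda>V1 V2. 2 * edge_weight_between \<mu> V1 V2 / (vol \<mu> V1 + vol \<mu> V2)"
  let ?S = "{?r V1 V2 | V1 V2. V1 \<noteq> {} \<and> V2 \<noteq> {} \<and> finite V1 \<and> finite V2 \<and>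
            V1 \<subseteq> - K \<and> V2 \<subseteq> - K \<and> V1 \<inter> V2 = {}}"
  have bdd: "bdd_above ?S"
  proof (rule bdd_aboveI)
    fix r assume "r \<in> ?S"
    then show "r \<le> 1" using dual_cheeger_ratio_bounds(2) by blast
  qed
  obtain x where x: "x \<in> - K" using infinite_Compl[OF K] by (metis finite.emptyI ex_in_conv)
  obtain y where y: "y \<in> - insert x K"
    using infinite_Compl[of "insert x K"] K by (metis finite.emptyI ex_in_conv finite_insert)
  have mem: "?r {x} {y} \<in> ?S"
    by (intro CollectI exI[of _ "{x}"] exI[of _ "{y}"] conjI refl) (use x y in auto)
  have upper: "?r V1 V2 \<le> dual_cheeger \<mu> (- K)"
    if "V1 \<noteq> {}" "V2 \<noteq> {}" "finite V1" "finite V2" "V1 \<subseteq> - K" "V2 \<subseteq> - K" "V1 \<inter> V2 = {}" for V1 V2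
    unfolding dual_cheeger_def using that by (intro cSup_upper[OF _ bdd]) blast
  have nonneg: "0 \<le> dual_cheeger \<mu> (- K)"
    using dual_cheeger_ratio_bounds(1)[of "{x}" "{y}"] upper[of "{x}" "{y}"] x y by force
  have small: "interior_small (1 - cheeger \<mu> (- K)) K"
    by (simp add: interior_small_iff_cheeger[OF K])
  show "dual_cheeger \<mu> (- K) \<le> 1 - cheeger \<mu> (- K)"
    unfolding dual_cheeger_def
  proof (rule cSup_least)
    show "?S \<noteq> {}" using mem by blast
    fix r assume "r \<in> ?S"
    then obtain V1 V2 where r: "r = ?r V1 V2" and V: "V1 \<noteq> {}" "V2 \<noteq> {}" "finite V1" "finite V2"
      "V1 \<subseteq> - K" "V2 \<subseteq> - K" "V1 \<inter> V2 = {}" by blast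
    have "2 * edge_weight_between \<mu> V1 V2 \<le> edge_weight_between \<mu> (V1 \<union> V2) (V1 \<union> V2)"
      using V edge_weight_nonneg[of V1 V1] edge_weight_nonneg[of V2 V2] by (simp add: edge_weight_Un)
    also have "\<dots> \<le> (1 - cheeger \<mu> (- K)) * vol \<mu> (V1 \<union> V2)"
      using small V by (simp add: interior_small_def)
    finally show "r \<le> 1 - cheeger \<mu> (- K)"
      using vol_pos[of "V1 \<union> V2"] V by (simp add: r vol_Un pos_divide_le_eq)
  qed
  assume no_loops: "\<And>x. \<mu> x x = 0"
  have "interior_small (2 * dual_cheeger \<mu> (- K)) K"
    unfolding interior_small_def
  proof (intro allI impI)
    fix U assume U: "finite U" "U \<subseteq> - K"
    obtain V1 V2 where V: "V1 \<union> V2 = U" "V1 \<inter> V2 = {}"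
      "edge_weight_between \<mu> U U \<le> 4 * edge_weight_between \<mu> V1 V2"
      using max_cut[OF no_loops U(1)] by blast
    have fin: "finite V1" "finite V2" using U(1) V(1) by auto
    show "edge_weight_between \<mu> U U \<le> 2 * dual_cheeger \<mu> (- K) * vol \<mu> U"
    proof (cases "V1 = {} \<or> V2 = {}")
      case True
      then have "edge_weight_between \<mu> V1 V2 = 0" by (auto simp: edge_weight_between_def)
      then show ?thesis
        using V(3) nonneg vol_nonneg[of U] by (smt (verit) mult_nonneg_nonneg)
    next
      case False
      then have "?r V1 V2 \<le> dual_cheeger \<mu> (- K)" using U V fin by (intro upper) auto
      moreover have "0 < vol \<mu> V1 + vol \<mu> V2" using vol_pos fin False by (simp add: add_pos_pos)
      ultimately have "2 * edge_weight_between \<mu> V1 V2 \<le> dual_cheeger \<mu> (- K) * vol \<mu> U"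
        using V(1,2) fin vol_Un[of V1 V2] by (simp add: pos_divide_le_eq)
      then show ?thesis using V(3) by linarith
    qed
  qed
  then show "1 - cheeger \<mu> (- K) \<le> 2 * dual_cheeger \<mu> (- K)"
    by (simp add: interior_small_iff_cheeger[OF K])
qed

lemma dual_cheeger_inf_eq_0_iff:
  assumes no_loops: "\<And>x. \<mu> x x = 0"
  shows "dual_cheeger_inf \<mu> = 0 \<longleftrightarrow> cheeger_inf \<mu> = 1"
proof -
  obtain K :: "nat \<Rightarrow> 'v set" where K: "exhaustion K" using exhaustion_exists by blast
  have fin: "finite (K n)" for n using K by (simp add: exhaustion_def)
  have lim: "(\<lambda>n. 1 - cheeger \<mu> (- K n)) \<longlonglongrightarrow> 1 - cheeger_inf \<mu>"
    by (intro tendsto_intros cheeger_inf_limit K)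
  have "dual_cheeger_inf \<mu> \<le> 1 - cheeger_inf \<mu>"
    by (rule LIMSEQ_le[OF dual_cheeger_inf_limit[OF K] lim]) (use dual_cheeger_bounds(1)[OF fin] in auto)
  moreover have "1 - cheeger_inf \<mu> \<le> 2 * dual_cheeger_inf \<mu>"
    by (rule LIMSEQ_le[OF lim tendsto_mult_left[OF dual_cheeger_inf_limit[OF K]]])
      (use dual_cheeger_bounds(2)[OF fin no_loops] in auto)
  ultimately show ?thesis by linarith
qed

section \<open>From sets to functions: level sets\<close>

text \<open>
  Writing \<open>g\<close> as a sum of multiples of indicator functions of its superlevel sets turns
  \<open>min (g x) (g y)\<close> into the corresponding combination of products of indicators, so that the claim is
  a positive combination of the hypotheses for the superlevel sets. The induction peels off the set \<open>U\<close> on which \<open>g\<close> is nonzero, with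
  the minimum \<open>m\<close> of \<open>g\<close> on \<open>U\<close> as its coefficient.
\<close>

lemma sum_min_le:
  assumes "finite S" and small: "\<And>U. U \<subseteq> S \<Longrightarrow> edge_weight_between \<mu> U U \<le> e * vol \<mu> U"
    and "\<And>x. x \<in> S \<Longrightarrow> 0 \<le> g x"
  shows "(\<Sum>x\<in>S. \<Sum>y\<in>S. \<mu> x y * min (g x) (g y)) \<le> e * (\<Sum>x\<in>S. vertex_weight \<mu> x * g x)"
  using assms(3)
proof (induction "card {x\<in>S. g x \<noteq> 0}" arbitrary: g rule: less_induct)
  case less
  define U where "U = {x\<in>S. g x \<noteq> 0}"
  have US: "U \<subseteq> S" and U: "finite U" using assms(1) by (auto simp: U_def)
  show ?case
  proof (cases "U = {}")
    case True
    then have "g x = 0" if "x \<in> S" for x using that by (auto simp: U_def)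
    then show ?thesis by simp
  next
    case False
    define m where "m = Min (g ` U)"
    have "m \<in> g ` U" unfolding m_def using U False by (intro Min_in) auto
    then obtain x0 where x0: "x0 \<in> U" "g x0 = m" by blast
    then have m: "0 < m" "\<And>x. x \<in> U \<Longrightarrow> m \<le> g x"
      using U less.prems[of x0] by (auto simp: m_def U_def order_less_le)
    define g' where "g' x = (if x \<in> U then g x - m else 0)" for x
    have "{x\<in>S. g' x \<noteq> 0} \<subset> U" using US x0 by (auto simp: g'_def)
    then have "card {x\<in>S. g' x \<noteq> 0} < card {x\<in>S. g x \<noteq> 0}"
      using U unfolding U_def[symmetric] by (rule psubset_card_mono[rotated])
    then have IH: "(\<Sum>x\<in>S. \<Sum>y\<in>S. \<mu> x y * min (g' x) (g' y)) \<le> e * (\<Sum>x\<in>S. vertex_weight \<mu> x * g' x)"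
      by (rule less.hyps) (use m(2) in \<open>auto simp: g'_def\<close>)
    have split: "(\<Sum>x\<in>S. if x \<in> U then f x else 0) = (\<Sum>x\<in>U. f x)" for f :: "'v \<Rightarrow> real"
      using US assms(1) by (simp add: sum.inter_restrict[symmetric] Int_absorb1)
    have "\<mu> x y * min (g x) (g y) =
        (if x \<in> U then if y \<in> U then m * \<mu> x y else 0 else 0) + \<mu> x y * min (g' x) (g' y)"
      if "x \<in> S" "y \<in> S" for x y
    proof -
      have out: "g z = 0" if "z \<in> S" "z \<notin> U" for z using that by (simp add: U_def)
      consider "x \<in> U" "y \<in> U" | "x \<in> U" "y \<notin> U" | "x \<notin> U" by blast
      then show ?thesis
      proof cases
        case 1
        then show ?thesis by (simp add: g'_def min_def algebra_simps)
      next
        case 2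
        then show ?thesis using m(2)[of x] m(1) out[of y] that by (simp add: g'_def)
      next
        case 3
        then show ?thesis using out[of x] less.prems[of y] m(2)[of y] that by (simp add: g'_def)
      qed
    qed
    then have "(\<Sum>x\<in>S. \<Sum>y\<in>S. \<mu> x y * min (g x) (g y)) =
        (\<Sum>x\<in>S. if x \<in> U then (\<Sum>y\<in>S. if y \<in> U then m * \<mu> x y else 0) else 0) +
        (\<Sum>x\<in>S. \<Sum>y\<in>S. \<mu> x y * min (g' x) (g' y))"
      unfolding sum.distrib[symmetric] by (intro sum.cong) (auto simp: sum.distrib)
    also have "(\<Sum>x\<in>S. if x \<in> U then (\<Sum>y\<in>S. if y \<in> U then m * \<mu> x y else 0) else 0)
        = m * edge_weight_between \<mu> U U"
      unfolding split by (simp add: edge_weight_between_def sum_distrib_left)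
    also have "\<dots> \<le> m * (e * vol \<mu> U)" using m(1) small[OF US] by (intro mult_left_mono) auto
    also have "m * (e * vol \<mu> U) = e * (\<Sum>x\<in>S. if x \<in> U then vertex_weight \<mu> x * m else 0)"
      unfolding split vol_def by (simp add: sum_distrib_left sum_distrib_right mult_ac)
    finally have "(\<Sum>x\<in>S. \<Sum>y\<in>S. \<mu> x y * min (g x) (g y)) \<le>
        e * (\<Sum>x\<in>S. if x \<in> U then vertex_weight \<mu> x * m else 0) + e * (\<Sum>x\<in>S. vertex_weight \<mu> x * g' x)"
      using IH by linarith
    also have "\<dots> = e * (\<Sum>x\<in>S. vertex_weight \<mu> x * g x)"
    proof -
      have "(if x \<in> U then vertex_weight \<mu> x * m else 0) + vertex_weight \<mu> x * g' x = vertex_weight \<mu> x * g x"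
        if "x \<in> S" for x using that by (auto simp: g'_def U_def algebra_simps)
      then show ?thesis
        unfolding distrib_left[symmetric] sum.distrib[symmetric] by simp
    qed
    finally show ?thesis .
  qed
qed

text \<open>
  With \<open>|f x f y| = sqrt (min (f x)\<^sup>2 (f y)\<^sup>2) sqrt (max (f x)\<^sup>2 (f y)\<^sup>2)\<close> the Cauchy-Schwarz inequality separates
  a minimum, which \<open>sum_min_le\<close> bounds by \<open>e\<close> times the squared norm, from a maximum, which is at
  most the sum of the two squares and contributes twice the squared norm. This is the part of Cheeger's inequality
  that is relevant when the Cheeger constant is close to \<open>1\<close>.
\<close>

lemma finite_form_bound:
  assumes S: "finite S" and small: "\<And>U. U \<subseteq> S \<Longrightarrow> edge_weight_between \<mu> U U \<le> e * vol \<mu> U"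
    and e: "0 \<le> e"
  shows "\<bar>\<Sum>x\<in>S. \<Sum>y\<in>S. \<mu> x y * (f x * f y)\<bar> \<le> sqrt (2 * e) * (\<Sum>x\<in>S. vertex_weight \<mu> x * (f x)\<^sup>2)"
proof -
  define N where "N = (\<Sum>x\<in>S. vertex_weight \<mu> x * (f x)\<^sup>2)"
  have N: "0 \<le> N" unfolding N_def by (intro sum_nonneg mult_nonneg_nonneg vertex_weight_nonneg) auto
  define a where "a = (\<lambda>(x, y). sqrt (\<mu> x y * min ((f x)\<^sup>2) ((f y)\<^sup>2)))"
  define b where "b = (\<lambda>(x, y). sqrt (\<mu> x y * max ((f x)\<^sup>2) ((f y)\<^sup>2)))"
  have ab: "a (x, y) * b (x, y) = \<mu> x y * (\<bar>f x\<bar> * \<bar>f y\<bar>)" for x y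
  proof -
    have "min ((f x)\<^sup>2) ((f y)\<^sup>2) * max ((f x)\<^sup>2) ((f y)\<^sup>2) = (f x * f y)\<^sup>2"
      by (auto simp: min_def max_def power_mult_distrib)
    then have "(\<mu> x y * min ((f x)\<^sup>2) ((f y)\<^sup>2)) * (\<mu> x y * max ((f x)\<^sup>2) ((f y)\<^sup>2)) = (\<mu> x y * (f x * f y))\<^sup>2"
      by (simp add: power_mult_distrib power2_eq_square mult_ac)
    then have "a (x, y) * b (x, y) = sqrt ((\<mu> x y * (f x * f y))\<^sup>2)"
      unfolding a_def b_def by (simp only: prod.case real_sqrt_mult[symmetric])
    then show ?thesis by (simp add: abs_mult weight_nonneg)
  qed
  have "(\<Sum>p\<in>S\<times>S. (a p)\<^sup>2) = (\<Sum>x\<in>S. \<Sum>y\<in>S. \<mu> x y * min ((f x)\<^sup>2) ((f y)\<^sup>2))"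
    unfolding sum.cartesian_product a_def
    by (intro sum.cong) (auto simp: weight_nonneg)
  also have "\<dots> \<le> e * N" unfolding N_def by (rule sum_min_le[OF S small]) auto
  finally have A: "(\<Sum>p\<in>S\<times>S. (a p)\<^sup>2) \<le> e * N" .
  have half: "(\<Sum>x\<in>S. \<Sum>y\<in>S. \<mu> x y * (f x)\<^sup>2) \<le> N"
    unfolding N_def sum_distrib_right[symmetric]
    by (intro sum_mono mult_right_mono sum_weight_le S) auto
  have "(\<Sum>p\<in>S\<times>S. (b p)\<^sup>2) = (\<Sum>x\<in>S. \<Sum>y\<in>S. \<mu> x y * max ((f x)\<^sup>2) ((f y)\<^sup>2))"
    unfolding sum.cartesian_product b_def
    by (intro sum.cong) (auto simp: weight_nonneg le_max_iff_disj)
  also have "\<dots> \<le> (\<Sum>x\<in>S. \<Sum>y\<in>S. \<mu> x y * (f x)\<^sup>2 + \<mu> x y * (f y)\<^sup>2)"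
    unfolding distrib_left[symmetric] by (intro sum_mono mult_left_mono weight_nonneg) auto
  also have "\<dots> = (\<Sum>x\<in>S. \<Sum>y\<in>S. \<mu> x y * (f x)\<^sup>2) + (\<Sum>x\<in>S. \<Sum>y\<in>S. \<mu> x y * (f x)\<^sup>2)"
    unfolding sum.distrib by (subst (2) sum.swap) (simp add: weight_sym)
  also have "\<dots> \<le> 2 * N" using half by simp
  finally have B: "(\<Sum>p\<in>S\<times>S. (b p)\<^sup>2) \<le> 2 * N" .
  have "\<bar>\<Sum>x\<in>S. \<Sum>y\<in>S. \<mu> x y * (f x * f y)\<bar> \<le> (\<Sum>x\<in>S. \<bar>\<Sum>y\<in>S. \<mu> x y * (f x * f y)\<bar>)"
    by (rule sum_abs)
  also have "\<dots> \<le> (\<Sum>x\<in>S. \<Sum>y\<in>S. \<bar>\<mu> x y * (f x * f y)\<bar>)" by (intro sum_mono sum_abs)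
  also have "\<dots> = (\<Sum>p\<in>S\<times>S. a p * b p)"
    unfolding sum.cartesian_product by (intro sum.cong) (auto simp: ab abs_mult weight_nonneg)
  also have "\<dots> \<le> sqrt (2 * e) * N"
  proof (rule power2_le_imp_le)
    have "(\<Sum>p\<in>S\<times>S. a p * b p)\<^sup>2 \<le> (\<Sum>p\<in>S\<times>S. (a p)\<^sup>2) * (\<Sum>p\<in>S\<times>S. (b p)\<^sup>2)"
      by (rule Cauchy_Schwarz_ineq_sum)
    also have "\<dots> \<le> (e * N) * (2 * N)" using A B N e by (intro mult_mono sum_nonneg) auto
    also have "\<dots> = (sqrt (2 * e) * N)\<^sup>2" using e by (simp add: power_mult_distrib) (simp add: power2_eq_square)
    finally show "(\<Sum>p\<in>S\<times>S. a p * b p)\<^sup>2 \<le> (sqrt (2 * e) * N)\<^sup>2" .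
  qed (use N e in simp)
  finally show ?thesis unfolding N_def .
qed

section \<open>The transition operator\<close>

abbreviation sqrt_weight :: "'v \<Rightarrow> real" where "sqrt_weight x \<equiv> sqrt (vertex_weight \<mu> x)"

lemma vertex_weight_neq_0 [simp]: "vertex_weight \<mu> x \<noteq> 0"
  using vertex_weight_pos[of x] by simp

lemma sqrt_weight_square: "sqrt_weight x * sqrt_weight x = vertex_weight \<mu> x"
  using vertex_weight_nonneg[of x] by simp

text \<open>
  The operator \<open>P f(x) = (1/\<mu>(x)) \<Sum>\<^sub>y \<mu>\<^sub>x\<^sub>y f(y)\<close>, conjugated by multiplication with \<open>sqrt \<mu>\<close>.
\<close>

definition transition :: "'v ell2 \<Rightarrow> 'v ell2" where
  "transition F = Abs_ell2 (\<lambda>x. \<Sum>y\<in>neighbours x. \<mu> x y / (sqrt_weight x * sqrt_weight y) * coord F y)"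

text \<open>
  By Jensen's inequality for the probability weights \<open>\<mu>\<^sub>x\<^sub>y / \<mu>(x)\<close>, \<open>\<mu>(x) |P f(x)|\<^sup>2 \<le> \<Sum>\<^sub>y \<mu>\<^sub>x\<^sub>y |f(y)|\<^sup>2\<close>, and the
  sum of the right hand side over \<open>x\<close> is the squared norm of \<open>f\<close>. Square-summability is part of this estimate,
  so that the coordinates of the image are obtained together with the norm bound.
\<close>

lemma transition_bounds:
  shows coord_transition: "coord (transition F) x =
    (\<Sum>y\<in>neighbours x. \<mu> x y / (sqrt_weight x * sqrt_weight y) * coord F y)"
    and norm_transition_le: "norm (transition F) \<le> norm F"
proof -
  let ?g = "\<lambda>x. \<Sum>y\<in>neighbours x. \<mu> x y / (sqrt_weight x * sqrt_weight y) * coord F y"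
  have point: "(?g x)\<^sup>2 \<le> (\<Sum>y\<in>neighbours x. \<mu> x y * ((coord F y)\<^sup>2 / vertex_weight \<mu> y))" for x
  proof -
    define a where "a y = sqrt (\<mu> x y) / sqrt_weight x" for y
    define b where "b y = sqrt (\<mu> x y) * coord F y / sqrt_weight y" for y
    have "?g x = (\<Sum>y\<in>neighbours x. a y * b y)"
      using weight_nonneg by (intro sum.cong) (auto simp: a_def b_def field_simps)
    then have "(?g x)\<^sup>2 \<le> (\<Sum>y\<in>neighbours x. (a y)\<^sup>2) * (\<Sum>y\<in>neighbours x. (b y)\<^sup>2)"
      using Cauchy_Schwarz_ineq_sum[of a b "neighbours x"] by simp
    also have "(\<Sum>y\<in>neighbours x. (a y)\<^sup>2) = (\<Sum>y\<in>neighbours x. \<mu> x y) / vertex_weight \<mu> x"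
      using weight_nonneg vertex_weight_nonneg by (simp add: a_def power_divide sum_divide_distrib)
    also have "\<dots> = 1" using vertex_weight_pos[of x] by (simp add: vertex_weight_neighbours)
    also have "1 * (\<Sum>y\<in>neighbours x. (b y)\<^sup>2) = (\<Sum>y\<in>neighbours x. \<mu> x y * ((coord F y)\<^sup>2 / vertex_weight \<mu> y))"
      using weight_nonneg vertex_weight_nonneg by (simp add: b_def power_divide power_mult_distrib)
    finally show ?thesis .
  qed
  have total: "(\<Sum>x\<in>A. (?g x)\<^sup>2) \<le> (norm F)\<^sup>2" if A: "finite A" for A
  proof -
    define Y where "Y = (\<Union>x\<in>A. neighbours x)"
    have Y: "finite Y" using A finite_neighbours by (simp add: Y_def)
    have ge0: "0 \<le> (coord F y)\<^sup>2 / vertex_weight \<mu> y" for y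
      using vertex_weight_nonneg by simp
    have "(\<Sum>x\<in>A. (?g x)\<^sup>2) \<le> (\<Sum>x\<in>A. \<Sum>y\<in>neighbours x. \<mu> x y * ((coord F y)\<^sup>2 / vertex_weight \<mu> y))"
      by (intro sum_mono point)
    also have "\<dots> \<le> (\<Sum>x\<in>A. \<Sum>y\<in>Y. \<mu> x y * ((coord F y)\<^sup>2 / vertex_weight \<mu> y))"
      using Y by (intro sum_mono sum_mono2 mult_nonneg_nonneg weight_nonneg ge0) (auto simp: Y_def)
    also have "\<dots> = (\<Sum>y\<in>Y. (\<Sum>x\<in>A. \<mu> y x) * ((coord F y)\<^sup>2 / vertex_weight \<mu> y))"
      by (subst sum.swap) (simp add: sum_distrib_right sum_divide_distrib weight_sym)
    also have "\<dots> \<le> (\<Sum>y\<in>Y. vertex_weight \<mu> y * ((coord F y)\<^sup>2 / vertex_weight \<mu> y))"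
      using A by (intro sum_mono mult_right_mono sum_weight_le ge0)
    also have "\<dots> = (\<Sum>y\<in>Y. (coord F y)\<^sup>2)"
      using vertex_weight_pos by (intro sum.cong) (auto simp: less_le)
    also have "\<dots> \<le> (norm F)\<^sup>2" by (rule sum_coord_le_norm[OF Y])
    finally show ?thesis .
  qed
  have B: "(\<lambda>x. (?g x)\<^sup>2) summable_on UNIV" "norm (Abs_ell2 ?g) \<le> norm F"
    by (rule Abs_ell2_bounded[OF _ norm_ge_zero], erule total)+
  show "coord (transition F) x = ?g x" unfolding transition_def by (subst coord_Abs[OF B(1)]) (rule refl)
  show "norm (transition F) \<le> norm F" unfolding transition_def by (rule B(2))
qed

lemma bounded_linear_transition: "bounded_linear transition"
proof (rule bounded_linear_intro[where K = 1])
  show "transition (F + G) = transition F + transition G" for F G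
    by (rule ell2_eqI) (simp add: coord_transition distrib_left sum.distrib)
  show "transition (r *\<^sub>R F) = r *\<^sub>R transition F" for r F
    by (rule ell2_eqI) (simp add: coord_transition sum_distrib_left mult_ac)
  show "norm (transition F) \<le> norm F * 1" for F by (simp add: norm_transition_le)
qed

lemma coord_transition_unit: "coord (transition (unit y)) x = \<mu> x y / (sqrt_weight x * sqrt_weight y)"
proof -
  have "coord (transition (unit y)) x = (\<Sum>z\<in>neighbours x. if z = y then \<mu> x y / (sqrt_weight x * sqrt_weight y) else 0)"
    unfolding coord_transition by (intro sum.cong) (auto simp: coord_unit)
  also have "\<dots> = (if y \<in> neighbours x then \<mu> x y / (sqrt_weight x * sqrt_weight y) else 0)"
    by (simp add: finite_neighbours)
  finally show ?thesis by (auto simp: weight_outside_neighbours)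
qed

lemma selfadjoint_transition: "selfadjoint transition"
proof -
  interpret bounded_linear transition by (rule bounded_linear_transition)
  have units: "transition F \<bullet> unit x = F \<bullet> transition (unit x)" for F x
  proof (rule bounded_linear_eq_on_units[where F = F])
    show "bounded_linear (\<lambda>F. transition F \<bullet> unit x)"
      using bounded_linear_compose[OF bounded_linear_inner_left bounded_linear_transition] by simp
    show "bounded_linear (\<lambda>F. F \<bullet> transition (unit x))" by (rule bounded_linear_inner_left)
    show "transition (unit y) \<bullet> unit x = unit y \<bullet> transition (unit x)" for y
      by (simp add: inner_commute[of "unit y"] inner_unit coord_transition_unit weight_sym mult_ac)
  qed
  have "transition F \<bullet> G = F \<bullet> transition G" for F G
  proof (rule bounded_linear_eq_on_units[where F = G])
    show "bounded_linear (\<lambda>G. transition F \<bullet> G)" by (rule bounded_linear_inner_right)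
    show "bounded_linear (\<lambda>G. F \<bullet> transition G)"
      using bounded_linear_compose[OF bounded_linear_inner_right bounded_linear_transition] by simp
  qed (rule units)
  then show ?thesis by (simp add: selfadjoint_def bounded_linear_transition)
qed

text \<open>
  \<open>finite_vector (\<lambda>x. sqrt_weight x * f x) S\<close> represents the finitely supported function \<open>f 1\<^sub>S\<close>.
\<close>

definition finite_vector :: "('v \<Rightarrow> real) \<Rightarrow> 'v set \<Rightarrow> 'v ell2" where
  "finite_vector c S = (\<Sum>x\<in>S. c x *\<^sub>R unit x)"

lemma finite_vector_inner:
  assumes "finite S" "finite S'"
  shows "finite_vector (\<lambda>x. sqrt_weight x * f x) S \<bullet> finite_vector (\<lambda>x. sqrt_weight x * g x) S' =
    (\<Sum>x\<in>S \<inter> S'. vertex_weight \<mu> x * (f x * g x))"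
proof -
  have "coord (finite_vector (\<lambda>x. sqrt_weight x * f x) S) y = (if y \<in> S then sqrt_weight y * f y else 0)" for y
    using assms by (simp add: finite_vector_def coord_unit if_distrib[of "(*) _"] cong: if_cong)
  then have "finite_vector (\<lambda>x. sqrt_weight x * f x) S \<bullet> finite_vector (\<lambda>x. sqrt_weight x * g x) S'
      = (\<Sum>x\<in>S'. sqrt_weight x * g x * (if x \<in> S then sqrt_weight x * f x else 0))"
    by (subst (2) finite_vector_def) (simp add: inner_sum_right inner_unit)
  also have "\<dots> = (\<Sum>x\<in>S'. if x \<in> S then vertex_weight \<mu> x * (f x * g x) else 0)"
  proof (intro sum.cong refl)
    fix x
    have "sqrt_weight x * g x * (sqrt_weight x * f x) = (sqrt_weight x * sqrt_weight x) * (f x * g x)" by (simp only: mult_ac)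
    then show "sqrt_weight x * g x * (if x \<in> S then sqrt_weight x * f x else 0)
        = (if x \<in> S then vertex_weight \<mu> x * (f x * g x) else 0)"
      unfolding sqrt_weight_square by simp
  qed
  also have "\<dots> = (\<Sum>x\<in>S' \<inter> S. vertex_weight \<mu> x * (f x * g x))"
    using assms by (simp add: sum.inter_restrict)
  finally show ?thesis by (simp add: Int_commute)
qed

lemma finite_vector_transition_inner:
  assumes "finite S" "finite S'"
  shows "transition (finite_vector (\<lambda>x. sqrt_weight x * f x) S) \<bullet> finite_vector (\<lambda>x. sqrt_weight x * g x) S' =
    (\<Sum>x\<in>S. \<Sum>y\<in>S'. \<mu> x y * (f x * g y))"
proof -
  interpret bounded_linear transition by (rule bounded_linear_transition)
  define C where "C = finite_vector (\<lambda>x. sqrt_weight x * g x) S'"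
  have "transition (finite_vector (\<lambda>x. sqrt_weight x * f x) S) \<bullet> C =
      (\<Sum>x\<in>S. sqrt_weight x * f x * (transition (unit x) \<bullet> C))"
    by (simp add: finite_vector_def sum scaleR inner_sum_left)
  also have "\<dots> = (\<Sum>x\<in>S. \<Sum>y\<in>S'. sqrt_weight x * f x * (sqrt_weight y * g y * coord (transition (unit x)) y))"
    by (simp add: C_def finite_vector_def inner_sum_right inner_unit sum_distrib_left)
  also have "\<dots> = (\<Sum>x\<in>S. \<Sum>y\<in>S'. \<mu> x y * (f x * g y))"
    by (intro sum.cong refl) (simp add: coord_transition_unit weight_sym)
  finally show ?thesis unfolding C_def .
qed

text \<open>
  The restrictions of \<open>F\<close> to finite sets converge to \<open>F\<close>, both sides are continuous in \<open>F\<close>, and for finite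
  support the claim is \<open>finite_form_bound\<close>.
\<close>

lemma transition_form_bound:
  assumes small: "interior_small e K" and e: "0 \<le> e" and F: "\<And>x. x \<in> K \<Longrightarrow> coord F x = 0"
  shows "\<bar>transition F \<bullet> F\<bar> \<le> sqrt (2 * e) * (F \<bullet> F)"
proof -
  define f where "f x = coord F x / sqrt_weight x" for x
  define T where "T A = finite_vector (\<lambda>x. sqrt_weight x * f x) A" for A
  have T_eq: "T A = (\<Sum>x\<in>A. coord F x *\<^sub>R unit x)" for A
    by (simp add: T_def finite_vector_def f_def)
  have T_lim: "(T \<longlongrightarrow> F) (finite_subsets_at_top UNIV)"
    using ell2_has_sum_units[of F] by (simp add: has_sum_def T_eq[abs_def])
  have bound: "\<bar>transition (T A) \<bullet> T A\<bar> \<le> sqrt (2 * e) * (T A \<bullet> T A)" if A: "finite A" for A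
  proof -
    have "T A = T (A - K)"
      unfolding T_eq using A F by (intro sum.mono_neutral_right) auto
    moreover have "\<bar>transition (T (A - K)) \<bullet> T (A - K)\<bar> \<le> sqrt (2 * e) * (T (A - K) \<bullet> T (A - K))"
    proof -
      have fin: "finite (A - K)" using A by simp
      have "edge_weight_between \<mu> U U \<le> e * vol \<mu> U" if "U \<subseteq> A - K" for U
        using small that finite_subset[OF that fin] by (auto simp: interior_small_def)
      from finite_form_bound[OF fin this e, of f] show ?thesis
        unfolding T_def finite_vector_transition_inner[OF fin fin] finite_vector_inner[OF fin fin]
        by (simp add: power2_eq_square)
    qed
    ultimately show ?thesis by simp
  qed
  show ?thesis
  proof (rule tendsto_le[OF finite_subsets_at_top_neq_bot])
    show "((\<lambda>A. \<bar>transition (T A) \<bullet> T A\<bar>) \<longlongrightarrow> \<bar>transition F \<bullet> F\<bar>) (finite_subsets_at_top UNIV)"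
      by (intro tendsto_intros T_lim bounded_linear.tendsto[OF bounded_linear_transition])
    show "((\<lambda>A. sqrt (2 * e) * (T A \<bullet> T A)) \<longlongrightarrow> sqrt (2 * e) * (F \<bullet> F)) (finite_subsets_at_top UNIV)"
      by (intro tendsto_intros T_lim)
    show "\<forall>\<^sub>F A in finite_subsets_at_top UNIV. \<bar>transition (T A) \<bullet> T A\<bar> \<le> sqrt (2 * e) * (T A \<bullet> T A)"
      using bound by (auto intro: eventually_finite_subsets_at_top_weakI)
  qed
qed

definition ell2_laplace :: "'v ell2 \<Rightarrow> 'v ell2" where "ell2_laplace F = F - transition F"

lemma selfadjoint_ell2_laplace: "selfadjoint ell2_laplace"
proof -
  have "bounded_linear ell2_laplace"
    unfolding ell2_laplace_def[abs_def] by (intro bounded_linear_sub bounded_linear_ident bounded_linear_transition)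
  then show ?thesis
    by (simp add: selfadjoint_def ell2_laplace_def inner_diff selfadjointD(2)[OF selfadjoint_transition])
qed

lemma ell2_laplace_form: "ell2_laplace F \<bullet> F = F \<bullet> F - transition F \<bullet> F"
  by (simp add: ell2_laplace_def inner_diff_left)

lemma ell2_laplace_form_nonneg: "0 \<le> ell2_laplace F \<bullet> F"
proof -
  have "transition F \<bullet> F \<le> norm (transition F) * norm F" by (rule norm_cauchy_schwarz)
  also have "\<dots> \<le> norm F * norm F" by (intro mult_right_mono norm_transition_le) simp
  finally show ?thesis by (simp add: ell2_laplace_form power2_eq_square flip: power2_norm_eq_inner)
qed

lemma infinite_range_unit: "infinite (range (unit :: 'v \<Rightarrow> 'v ell2))"
proof -
  have "inj (unit :: 'v \<Rightarrow> 'v ell2)"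
  proof
    fix x y :: 'v assume "unit x = unit y"
    then have "coord (unit x) x = coord (unit y) x" by simp
    then show "x = y" by (simp add: coord_unit split: if_splits)
  qed
  then show ?thesis using infinite_vertices by (simp add: finite_image_iff)
qed

text \<open>
  A vector vanishes on \<open>K\<close> exactly if it is orthogonal to the finitely many unit vectors of \<open>K\<close>, so
  \<open>transition_form_bound\<close> is the hypothesis of \<open>essential_spectrum_single\<close>.
\<close>

lemma essential_spectrum_ell2_laplace_if:
  assumes small: "\<And>e. e > 0 \<Longrightarrow> \<exists>K. finite K \<and> interior_small e K"
  shows "essential_spectrum ell2_laplace = {1}"
proof (rule essential_spectrum_single[OF selfadjoint_ell2_laplace])
  fix e :: real assume e: "e > 0"
  \<comment> \<open>The value e^2/2 makes the bound sqrt (2 (e^2/2)) equal to e.\<close>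
  then obtain K where K: "finite K" "interior_small (e\<^sup>2 / 2) K"
    using small[of "e\<^sup>2 / 2"] by auto
  have "\<bar>shift ell2_laplace 1 F \<bullet> F\<bar> \<le> e * (F \<bullet> F)" if "F \<in> (unit ` K)\<^sup>\<bottom>" for F
  proof -
    have "coord F x = 0" if "x \<in> K" for x
      using \<open>F \<in> _\<close> that by (simp add: mem_orthogonal_comp inner_commute[of _ F] inner_unit)
    then have "\<bar>transition F \<bullet> F\<bar> \<le> sqrt (2 * (e\<^sup>2 / 2)) * (F \<bullet> F)"
      by (intro transition_form_bound[OF K(2)]) auto
    then show ?thesis using e by (simp add: ell2_laplace_def inner_diff_left)
  qed
  then show "\<exists>B. finite B \<and> (\<forall>F\<in>B\<^sup>\<bottom>. \<bar>shift ell2_laplace 1 F \<bullet> F\<bar> \<le> e * (F \<bullet> F))"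
    using K(1) by (intro exI[of _ "unit ` K"]) auto
next
  fix B :: "'v ell2 set" assume "finite B"
  have "pairwise orthogonal (range (unit :: 'v \<Rightarrow> 'v ell2))"
    by (auto simp: pairwise_def orthogonal_def inner_unit coord_unit)
  moreover have "0 \<notin> range (unit :: 'v \<Rightarrow> 'v ell2)"
  proof
    assume "0 \<in> range (unit :: 'v \<Rightarrow> 'v ell2)"
    then obtain x :: 'v where "0 = unit x" by blast
    then have "coord 0 x = coord (unit x) x" by simp
    then show False by (simp add: coord_unit)
  qed
  ultimately show "\<exists>F\<in>B\<^sup>\<bottom>. F \<noteq> 0"
    using infinite_orthogonal_meets_finite_codim[OF infinite_range_unit _ _ \<open>finite B\<close>] by blast
qed

definition indicator_vector :: "'v set \<Rightarrow> 'v ell2" where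
  "indicator_vector U = finite_vector (\<lambda>x. sqrt_weight x * 1) U"

lemma indicator_vector_inner:
  "finite U \<Longrightarrow> finite V \<Longrightarrow> indicator_vector U \<bullet> indicator_vector V = vol \<mu> (U \<inter> V)"
  unfolding indicator_vector_def by (subst finite_vector_inner) (auto simp: vol_def)

lemma indicator_vector_transition_inner:
  "finite U \<Longrightarrow> finite V \<Longrightarrow> transition (indicator_vector U) \<bullet> indicator_vector V = edge_weight_between \<mu> U V"
  unfolding indicator_vector_def by (subst finite_vector_transition_inner) (auto simp: edge_weight_between_def)

text \<open>
  Each new set is chosen outside the earlier sets and their neighbours. This excluded set stays
  finite because the graph is locally finite.
\<close>

lemma far_apart_sequence:
  assumes "\<And>K. finite K \<Longrightarrow> \<not> interior_small e K"
  obtains U :: "nat \<Rightarrow> 'v set" where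
    "\<And>n. finite (U n)" "\<And>n. e * vol \<mu> (U n) < edge_weight_between \<mu> (U n) (U n)"
    "\<And>m n. m \<noteq> n \<Longrightarrow> U m \<inter> U n = {}"
    "\<And>m n. m \<noteq> n \<Longrightarrow> edge_weight_between \<mu> (U m) (U n) = 0"
proof -
  have "\<forall>K. \<exists>U. finite K \<longrightarrow> finite U \<and> U \<subseteq> - K \<and> e * vol \<mu> U < edge_weight_between \<mu> U U"
    using assms by (auto simp: interior_small_def not_le)
  then obtain pick where pick: "\<And>K. finite K \<Longrightarrow>
      finite (pick K) \<and> pick K \<subseteq> - K \<and> e * vol \<mu> (pick K) < edge_weight_between \<mu> (pick K) (pick K)"
    by metis
  define step where "step K = K \<union> pick K \<union> (\<Union>x\<in>pick K. neighbours x)" for K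
  define K where "K n = (step ^^ n) {}" for n
  have K_Suc: "K (Suc n) = step (K n)" for n by (simp add: K_def)
  have finK: "finite (K n)" for n
  proof (induction n)
    case 0
    then show ?case by (simp add: K_def)
  next
    case (Suc n)
    then show ?case using pick[OF Suc] finite_neighbours by (simp add: K_Suc step_def)
  qed
  have mono: "incseq K" by (rule incseq_SucI) (auto simp: K_Suc step_def)
  define U where "U n = pick (K n)" for n
  have U: "finite (U n)" "U n \<subseteq> - K n" "e * vol \<mu> (U n) < edge_weight_between \<mu> (U n) (U n)" for n
    using pick[OF finK, of n] by (auto simp: U_def)
  have later: "U m \<inter> U n = {} \<and> edge_weight_between \<mu> (U m) (U n) = 0" if "m < n" for m n
  proof -
    have "K (Suc m) \<subseteq> K n" using mono that by (auto simp: incseq_def)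
    then have K: "U m \<subseteq> K n" "\<And>x. x \<in> U m \<Longrightarrow> neighbours x \<subseteq> K n" by (auto simp: K_Suc step_def U_def)
    have "\<mu> x y = 0" if "x \<in> U m" "y \<in> U n" for x y
      using K(2)[OF that(1)] U(2)[of n] that(2) by (intro weight_outside_neighbours) blast
    then show ?thesis using K(1) U(2)[of n] by (auto simp: edge_weight_between_def)
  qed
  have sym: "edge_weight_between \<mu> V W = edge_weight_between \<mu> W V" for V W
    unfolding edge_weight_between_def by (subst sum.swap) (simp add: weight_sym)
  show ?thesis
  proof (rule that[of U])
    show "U m \<inter> U n = {}" if "m \<noteq> n" for m n
      using later[of m n] later[of n m] that by (auto simp: neq_iff)
    show "edge_weight_between \<mu> (U m) (U n) = 0" if "m \<noteq> n" for m n
      using later[of m n] later[of n m] that sym[of "U m" "U n"] by (auto simp: neq_iff)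
  qed (use U in auto)
qed

text \<open>
  On the span of the indicators of far apart sets the form of the transition operator is at least \<open>e\<close>,
  whereas by \<open>form_bound_of_essential_spectrum\<close> it is at most \<open>e/2\<close> on a subspace of finite codimension.
\<close>

lemma interior_small_if_essential_spectrum:
  assumes ess: "essential_spectrum ell2_laplace = {1}" and e: "e > 0"
  shows "\<exists>K. finite K \<and> interior_small e K"
proof (rule ccontr)
  assume "\<not> ?thesis"
  then have none: "\<And>K. finite K \<Longrightarrow> \<not> interior_small e K" by blast
  obtain U :: "nat \<Rightarrow> 'v set" where U: "\<And>n. finite (U n)"
    "\<And>n. e * vol \<mu> (U n) < edge_weight_between \<mu> (U n) (U n)"
    "\<And>m n. m \<noteq> n \<Longrightarrow> U m \<inter> U n = {}"
    "\<And>m n. m \<noteq> n \<Longrightarrow> edge_weight_between \<mu> (U m) (U n) = 0"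
    using far_apart_sequence[OF none] by blast
  have ne: "U n \<noteq> {}" for n
    using U(2)[of n] by (auto simp: vol_def edge_weight_between_def)
  define u where "u n = indicator_vector (U n)" for n
  have orth: "u m \<bullet> u n = 0" "transition (u m) \<bullet> u n = 0" if "m \<noteq> n" for m n
    using that U by (simp_all add: u_def indicator_vector_inner indicator_vector_transition_inner vol_def)
  have pos: "u n \<bullet> u n > 0" for n
    using U(1) ne by (simp add: u_def indicator_vector_inner vol_pos del: inner_gt_zero_iff)
  have diag: "e * (u n \<bullet> u n) \<le> transition (u n) \<bullet> u n" for n
    using U(1) U(2)[of n] by (simp add: u_def indicator_vector_inner indicator_vector_transition_inner less_imp_le)
  have "inj u"
  proof (rule injI)
    fix m n assume "u m = u n"
    then show "m = n" using orth(1)[of m n] pos[of n] by (cases "m = n") auto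
  qed
  then have inf: "infinite (range u)" by (simp add: finite_image_iff)
  have po: "pairwise orthogonal (range u)"
    unfolding pairwise_def orthogonal_def using orth(1) by (metis imageE)
  have n0: "0 \<notin> range u" using pos by (metis imageE inner_zero_left less_irrefl)
  have "essential_spectrum ell2_laplace \<inter> {0..1 - e / 2} = {}" using ess e by auto
  then obtain B where B: "finite B" "\<And>F. F \<in> B\<^sup>\<bottom> \<Longrightarrow> (1 - e / 2) * (F \<bullet> F) \<le> ell2_laplace F \<bullet> F"
    using form_bound_of_essential_spectrum[OF selfadjoint_ell2_laplace, of 0 "1 - e / 2"] ell2_laplace_form_nonneg by auto
  obtain F where F: "F \<in> span (range u)" "F \<in> B\<^sup>\<bottom>" "F \<noteq> 0"
    using infinite_orthogonal_meets_finite_codim[OF inf po n0 B(1)] by blast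
  have "e * (F \<bullet> F) \<le> transition F \<bullet> F"
  proof (rule form_lower_bound_on_span[OF bounded_linear.linear[OF bounded_linear_transition] _ _ F(1)])
    show "v \<bullet> w = 0 \<and> transition v \<bullet> w = 0" if vw: "v \<in> range u" "w \<in> range u" "v \<noteq> w" for v w
    proof -
      obtain m n where "v = u m" "w = u n" using vw(1,2) by blast
      then show ?thesis using orth[of m n] vw(3) by (cases "m = n") auto
    qed
    show "e * (v \<bullet> v) \<le> transition v \<bullet> v" if v: "v \<in> range u" for v
    proof -
      obtain n where "v = u n" using v by blast
      then show ?thesis using diag by simp
    qed
  qed
  moreover have "transition F \<bullet> F \<le> e / 2 * (F \<bullet> F)"
    using B(2)[OF F(2)] by (simp add: ell2_laplace_form algebra_simps)
  moreover have "e / 2 * (F \<bullet> F) < e * (F \<bullet> F)"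
    using F(3) e by (intro mult_strict_right_mono) auto
  ultimately show False by linarith
qed

section \<open>The weighted space and its Laplace operator\<close>

text \<open>
  Multiplication by \<open>sqrt \<mu>\<close> and its inverse are mutually inverse isometries between the weighted and
  the unweighted space, and they intertwine the two Laplace operators (\<open>laplace_of_ell2\<close>).
\<close>

definition to_ell2 :: "('v \<Rightarrow> real) \<Rightarrow> 'v ell2" where "to_ell2 f = Abs_ell2 (\<lambda>x. sqrt_weight x * f x)"

definition of_ell2 :: "'v ell2 \<Rightarrow> 'v \<Rightarrow> real" where "of_ell2 F = (\<lambda>x. coord F x / sqrt_weight x)"

lemma l2_iff: "f \<in> l2 \<mu> \<longleftrightarrow> (\<lambda>x. (sqrt_weight x * f x)\<^sup>2) summable_on UNIV"
  by (simp add: l2_def power_mult_distrib vertex_weight_nonneg)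

lemma coord_to_ell2: "f \<in> l2 \<mu> \<Longrightarrow> coord (to_ell2 f) x = sqrt_weight x * f x"
  by (simp add: to_ell2_def l2_iff coord_Abs)

lemma of_ell2_l2: "of_ell2 F \<in> l2 \<mu>"
  using coord_square_summable[of F] by (simp add: l2_iff of_ell2_def)

lemma to_ell2_of_ell2: "to_ell2 (of_ell2 F) = F"
  by (rule ell2_eqI) (simp only: coord_to_ell2[OF of_ell2_l2], simp add: of_ell2_def)

lemma of_ell2_to_ell2: "f \<in> l2 \<mu> \<Longrightarrow> of_ell2 (to_ell2 f) = f"
  by (simp add: of_ell2_def coord_to_ell2 fun_eq_iff)

lemma inj_of_ell2: "inj of_ell2"
  by (metis to_ell2_of_ell2 injI)

lemma l2_norm_eq: "f \<in> l2 \<mu> \<Longrightarrow> l2_norm \<mu> f = norm (to_ell2 f)"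
proof -
  assume f: "f \<in> l2 \<mu>"
  have "vertex_weight \<mu> x * f x * f x = (sqrt_weight x * f x)\<^sup>2" for x
    by (simp add: power_mult_distrib vertex_weight_nonneg) (simp add: power2_eq_square)
  then have "l2_inner \<mu> f f = (norm (to_ell2 f))\<^sup>2"
    by (simp add: l2_inner_def norm_ell2_square coord_to_ell2[OF f])
  then show ?thesis by (simp add: l2_norm_def)
qed

lemma of_ell2_add: "of_ell2 (F + G) = (\<lambda>x. of_ell2 F x + of_ell2 G x)"
  and of_ell2_diff: "of_ell2 (F - G) = (\<lambda>x. of_ell2 F x - of_ell2 G x)"
  and of_ell2_scale: "of_ell2 (c *\<^sub>R F) = (\<lambda>x. c * of_ell2 F x)"
  by (simp_all add: of_ell2_def add_divide_distrib diff_divide_distrib)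

lemma laplace_of_ell2: "laplace \<mu> (of_ell2 F) = of_ell2 (ell2_laplace F)"
proof
  fix x
  have cancel: "1 / (s * s) * (m * (a / t)) = m / (s * t) * a / s" for s t m a :: real
    by (simp add: field_simps)
  have "1 / (sqrt_weight x * sqrt_weight x) * (\<Sum>y\<in>neighbours x. \<mu> x y * of_ell2 F y)
      = (\<Sum>y\<in>neighbours x. \<mu> x y / (sqrt_weight x * sqrt_weight y) * coord F y) / sqrt_weight x"
    unfolding sum_distrib_left sum_divide_distrib of_ell2_def cancel ..
  then have "1 / vertex_weight \<mu> x * (\<Sum>y\<in>neighbours x. \<mu> x y * of_ell2 F y)
      = (\<Sum>y\<in>neighbours x. \<mu> x y / (sqrt_weight x * sqrt_weight y) * coord F y) / sqrt_weight x"
    unfolding sqrt_weight_square .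
  then show "laplace \<mu> (of_ell2 F) x = of_ell2 (ell2_laplace F) x"
    unfolding laplace_def infsum_weight
    by (simp only:) (simp add: ell2_laplace_def coord_transition of_ell2_def diff_divide_distrib)
qed

lemma shift_laplace_of_ell2:
  "(\<lambda>x. laplace \<mu> (of_ell2 F) x - t * of_ell2 F x) = of_ell2 (shift ell2_laplace t F)"
  by (simp add: laplace_of_ell2 of_ell2_diff of_ell2_scale)

text \<open>
  A bounded inverse provides a lower bound for the operator. Conversely a lower bound gives injectivity,
  surjectivity by \<open>surj_if_bounded_below\<close>, and boundedness of the inverse.
\<close>

lemma l2_spectrum_laplace: "l2_spectrum \<mu> (laplace \<mu>) = approximate_spectrum ell2_laplace"
proof -
  have "(\<exists>R. l2_bounded_operator \<mu> R \<and> (\<forall>f\<in>l2 \<mu>. R (\<lambda>x. laplace \<mu> f x - t * f x) = f \<and>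
      (\<lambda>x. laplace \<mu> (R f) x - t * R f x) = f)) \<longleftrightarrow> bounded_below_on UNIV (shift ell2_laplace t)" for t
  proof
    assume "\<exists>R. l2_bounded_operator \<mu> R \<and> (\<forall>f\<in>l2 \<mu>. R (\<lambda>x. laplace \<mu> f x - t * f x) = f \<and>
      (\<lambda>x. laplace \<mu> (R f) x - t * R f x) = f)"
    then obtain R where R0: "l2_bounded_operator \<mu> R"
      and R: "\<And>f. f \<in> l2 \<mu> \<Longrightarrow> R (\<lambda>x. laplace \<mu> f x - t * f x) = f" by blast
    obtain C where C: "\<And>f. f \<in> l2 \<mu> \<Longrightarrow> l2_norm \<mu> (R f) \<le> C * l2_norm \<mu> f"
      using R0 unfolding l2_bounded_operator_def by blast
    have "1 / max 1 C * norm F \<le> norm (shift ell2_laplace t F)" for F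
    proof -
      have "norm F = l2_norm \<mu> (of_ell2 F)" by (simp add: l2_norm_eq of_ell2_l2 to_ell2_of_ell2)
      also have "of_ell2 F = R (of_ell2 (shift ell2_laplace t F))"
        using R[OF of_ell2_l2, of F] by (simp add: shift_laplace_of_ell2)
      also have "l2_norm \<mu> \<dots> \<le> C * norm (shift ell2_laplace t F)"
        using C[OF of_ell2_l2, of "shift ell2_laplace t F"] by (simp add: l2_norm_eq of_ell2_l2 to_ell2_of_ell2)
      also have "\<dots> \<le> max 1 C * norm (shift ell2_laplace t F)" by (intro mult_right_mono) auto
      finally show ?thesis by (simp add: field_simps)
    qed
    then show "bounded_below_on UNIV (shift ell2_laplace t)"
      unfolding bounded_below_on_def by (intro exI[of _ "1 / max 1 C"]) auto
  next
    assume bb: "bounded_below_on UNIV (shift ell2_laplace t)"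
    then obtain c where c: "c > 0" "\<And>F. c * norm F \<le> norm (shift ell2_laplace t F)"
      by (auto simp: bounded_below_on_def)
    define D where "D = shift ell2_laplace t"
    have D: "selfadjoint D" unfolding D_def by (intro selfadjoint_shift selfadjoint_ell2_laplace)
    interpret bounded_linear D using D by (rule selfadjointD)
    have cD: "c * norm F \<le> norm (D F)" for F unfolding D_def by (rule c(2))
    have "inj D"
    proof (rule injI)
      fix F G assume "D F = D G"
      then have "c * norm (F - G) \<le> 0" using cD[of "F - G"] by (simp add: diff)
      then show "F = G" using c(1) by (simp add: mult_le_0_iff)
    qed
    moreover have "surj D" using surj_if_bounded_below[OF D] bb by (simp add: D_def)
    ultimately have DI: "inv D (D F) = F" "D (inv D F) = F" for F
      by (simp_all add: surj_f_inv_f)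
    have lin: "inv D (F + G) = inv D F + inv D G" "inv D (r *\<^sub>R F) = r *\<^sub>R inv D F" for F G r
      by (rule injD[OF \<open>inj D\<close>], simp add: add scaleR DI)+
    have bnd: "norm (inv D F) \<le> 1 / c * norm F" for F
      using cD[of "inv D F"] c(1) DI(2)[of F] by (simp add: field_simps)
    define R where "R f = of_ell2 (inv D (to_ell2 f))" for f
    have emb_add: "to_ell2 (\<lambda>x. f x + g x) = to_ell2 f + to_ell2 g" if "f \<in> l2 \<mu>" "g \<in> l2 \<mu>" for f g
      using to_ell2_of_ell2[of "to_ell2 f + to_ell2 g"] that by (simp add: of_ell2_add of_ell2_to_ell2)
    have emb_scale: "to_ell2 (\<lambda>x. r * f x) = r *\<^sub>R to_ell2 f" if "f \<in> l2 \<mu>" for f r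
      using to_ell2_of_ell2[of "r *\<^sub>R to_ell2 f"] that by (simp add: of_ell2_scale of_ell2_to_ell2)
    have "l2_bounded_operator \<mu> R"
      unfolding l2_bounded_operator_def
    proof (intro conjI ballI allI exI[of _ "1 / c"])
      show "l2_norm \<mu> (R f) \<le> 1 / c * l2_norm \<mu> f" if "f \<in> l2 \<mu>" for f
        using bnd[of "to_ell2 f"] that by (simp add: l2_norm_eq R_def of_ell2_l2 to_ell2_of_ell2)
    qed (simp_all add: R_def of_ell2_l2 emb_add emb_scale lin of_ell2_add of_ell2_scale)
    moreover have "R (\<lambda>x. laplace \<mu> f x - t * f x) = f \<and> (\<lambda>x. laplace \<mu> (R f) x - t * R f x) = f"
      if f: "f \<in> l2 \<mu>" for f
    proof
      have "(\<lambda>x. laplace \<mu> f x - t * f x) = of_ell2 (D (to_ell2 f))"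
        using shift_laplace_of_ell2[of "to_ell2 f" t] by (simp add: of_ell2_to_ell2[OF f] D_def)
      then show "R (\<lambda>x. laplace \<mu> f x - t * f x) = f"
        by (simp add: R_def to_ell2_of_ell2 DI of_ell2_to_ell2[OF f])
      show "(\<lambda>x. laplace \<mu> (R f) x - t * R f x) = f"
      proof -
        have "of_ell2 (D (inv D (to_ell2 f))) = f" by (simp add: DI of_ell2_to_ell2[OF f])
        then show ?thesis unfolding R_def shift_laplace_of_ell2 by (simp only: D_def)
      qed
    qed
    ultimately show "\<exists>R. l2_bounded_operator \<mu> R \<and> (\<forall>f\<in>l2 \<mu>. R (\<lambda>x. laplace \<mu> f x - t * f x) = f \<and>
      (\<lambda>x. laplace \<mu> (R f) x - t * R f x) = f)" by blast
  qed
  then show ?thesis by (simp add: l2_spectrum_def approximate_spectrum_def)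
qed

lemma l2_eigenspace_laplace: "l2_eigenspace \<mu> (laplace \<mu>) t = of_ell2 ` eigenspace ell2_laplace t"
proof (intro equalityI subsetI)
  fix f assume "f \<in> l2_eigenspace \<mu> (laplace \<mu>) t"
  then have f: "f \<in> l2 \<mu>" "laplace \<mu> f = (\<lambda>x. t * f x)" by (auto simp: l2_eigenspace_def)
  have "of_ell2 (ell2_laplace (to_ell2 f)) = of_ell2 (t *\<^sub>R to_ell2 f)"
    using f by (simp add: laplace_of_ell2[symmetric] of_ell2_to_ell2 of_ell2_scale)
  then have "to_ell2 f \<in> eigenspace ell2_laplace t"
    using inj_of_ell2 by (simp add: eigenspace_def inj_eq)
  then show "f \<in> of_ell2 ` eigenspace ell2_laplace t" using of_ell2_to_ell2[OF f(1)] by (metis imageI)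
next
  fix f assume "f \<in> of_ell2 ` eigenspace ell2_laplace t"
  then show "f \<in> l2_eigenspace \<mu> (laplace \<mu>) t"
    by (auto simp: l2_eigenspace_def eigenspace_def laplace_of_ell2 of_ell2_scale of_ell2_l2)
qed

lemma of_ell2_sum: "of_ell2 (\<Sum>i\<in>I. c i *\<^sub>R F i) = (\<lambda>x. \<Sum>i\<in>I. c i * of_ell2 (F i) x)"
  by (simp add: of_ell2_def sum_divide_distrib)

text \<open>
  Finite spanning sets correspond to each other because \<open>of_ell2\<close> is linear and injective.
\<close>

lemma finite_dimensional_of_ell2:
  "finite_dimensional (of_ell2 ` N) \<longleftrightarrow> (\<exists>C. finite C \<and> C \<subseteq> N \<and> N \<subseteq> span C)"
proof
  assume "finite_dimensional (of_ell2 ` N)"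
  then obtain B where B: "finite B" "B \<subseteq> of_ell2 ` N" "\<forall>f\<in>of_ell2 ` N. \<exists>c. f = (\<lambda>x. \<Sum>b\<in>B. c b * b x)"
    by (auto simp: finite_dimensional_def)
  then obtain C where C: "C \<subseteq> N" "finite C" "B = of_ell2 ` C"
    using finite_subset_image[OF B(1,2)] by blast
  have "F \<in> span C" if F: "F \<in> N" for F
  proof -
    obtain c where "of_ell2 F = (\<lambda>x. \<Sum>b\<in>B. c b * b x)"
      using B(3)[rule_format, OF imageI[OF F]] by (elim exE)
    also have "\<dots> = (\<lambda>x. \<Sum>G\<in>C. c (of_ell2 G) * of_ell2 G x)"
      unfolding C(3) by (simp add: sum.reindex[OF inj_on_subset[OF inj_of_ell2 subset_UNIV]] o_def)
    also have "\<dots> = of_ell2 (\<Sum>G\<in>C. c (of_ell2 G) *\<^sub>R G)" by (simp add: of_ell2_sum)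
    finally have "F = (\<Sum>G\<in>C. c (of_ell2 G) *\<^sub>R G)" using inj_of_ell2 by (simp add: inj_eq)
    also have "\<dots> \<in> span C" by (intro span_sum span_scale span_base)
    finally show ?thesis .
  qed
  then show "\<exists>C. finite C \<and> C \<subseteq> N \<and> N \<subseteq> span C" using C by blast
next
  assume "\<exists>C. finite C \<and> C \<subseteq> N \<and> N \<subseteq> span C"
  then obtain C where C: "finite C" "C \<subseteq> N" "N \<subseteq> span C" by blast
  have coeffs: "\<exists>c. of_ell2 F = (\<lambda>x. \<Sum>b\<in>of_ell2 ` C. c b * b x)" if F: "F \<in> N" for F
  proof -
    have "F \<in> span C" using C(3) F by blast
    then obtain c where "F = (\<Sum>G\<in>C. c G *\<^sub>R G)" by (auto simp: span_finite[OF C(1)])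
    then have "of_ell2 F = (\<lambda>x. \<Sum>b\<in>of_ell2 ` C. c (to_ell2 b) * b x)"
      by (simp add: sum.reindex[OF inj_on_subset[OF inj_of_ell2 subset_UNIV]] of_ell2_sum o_def to_ell2_of_ell2)
    then show ?thesis by (rule exI[of _ "\<lambda>b. c (to_ell2 b)"])
  qed
  show "finite_dimensional (of_ell2 ` N)"
    unfolding finite_dimensional_def
  proof (intro exI[of _ "of_ell2 ` C"] conjI ballI)
    show "finite (of_ell2 ` C)" using C(1) by simp
    show "of_ell2 ` C \<subseteq> of_ell2 ` N" using C(2) by (rule image_mono)
    fix f assume "f \<in> of_ell2 ` N"
    then obtain F where F: "F \<in> N" "f = of_ell2 F" by blast
    show "\<exists>c. f = (\<lambda>x. \<Sum>b\<in>of_ell2 ` C. c b * b x)" unfolding F(2) by (rule coeffs[OF F(1)])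
  qed
qed

lemma l2_essential_spectrum_laplace: "l2_essential_spectrum \<mu> (laplace \<mu>) = essential_spectrum ell2_laplace"
proof -
  have "of_ell2 ` {0} = {\<lambda>x. 0}" by (auto simp: of_ell2_def)
  then have "l2_eigenspace \<mu> (laplace \<mu>) t = {\<lambda>x. 0} \<longleftrightarrow> eigenspace ell2_laplace t = {0}" for t
    unfolding l2_eigenspace_laplace by (metis inj_image_eq_iff inj_of_ell2)
  then show ?thesis
    by (simp add: l2_essential_spectrum_def essential_spectrum_def l2_spectrum_laplace
        l2_eigenspace_laplace finite_dimensional_of_ell2)
qed

end

theorem theorem1p1:
  fixes E :: "('v \<times> 'v) set" and \<mu> :: "'v \<Rightarrow> 'v \<Rightarrow> real"
  assumes "weighted_graph E \<mu>"
    and no_loops: "\<And>x. \<mu> x x = 0"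
  shows "(dual_cheeger_inf \<mu> = 0 \<longleftrightarrow> cheeger_inf \<mu> = 1) \<and>
         (cheeger_inf \<mu> = 1 \<longleftrightarrow> l2_essential_spectrum \<mu> (laplace \<mu>) = {1})"
proof -
  interpret weighted_graph E \<mu> by fact
  have "cheeger_inf \<mu> = 1 \<longleftrightarrow> l2_essential_spectrum \<mu> (laplace \<mu>) = {1}"
    unfolding cheeger_inf_eq_1_iff l2_essential_spectrum_laplace
  proof
    assume "\<forall>e>0. \<exists>K. finite K \<and> interior_small e K"
    then show "essential_spectrum ell2_laplace = {1}" by (intro essential_spectrum_ell2_laplace_if) simp
  next
    assume "essential_spectrum ell2_laplace = {1}"
    then show "\<forall>e>0. \<exists>K. finite K \<and> interior_small e K"
      using interior_small_if_essential_spectrum by simp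
  qed
  then show ?thesis using dual_cheeger_inf_eq_0_iff[OF no_loops] by blast
qed

end
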